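(* Let $(x,\lambda):[t_0,\infty)\to\mathbb{R}^n\times\mathbb{R}^m$ be a solution (with $x\in C^2$, $\lambda\in C^1$) of the dynamical system $$ \begin{aligned} &\ddot x(t)+\delta\sqrt{\varepsilon(t)}\,\dot x(t)+\nabla f\bigl(x(t)+\beta(t)\dot x(t)\bigr)+A^\top\lambda(t)+\rho A^\top\bigl(A(x(t)+\beta(t)\dot x(t))-b\bigr)+\varepsilon(t)x(t)=0,\\ &\dot\lambda(t)=\frac{\gamma}{\sqrt{\varepsilon(t)}}\Bigl[A\Bigl(x(t)+\frac{\gamma}{\sigma\sqrt{\varepsilon(t)}}\dot x(t)\Bigr)-b\Bigr], \end{aligned} $$ where the data satisfy the standing assumptions of the context. Let $x^*=P_S(0)$ and let $\lambda^\dagger\in\mathbb{R}^m$ be the multiplier with $\nabla f(x^* )+A^\top\lambda^\dagger=0$ and $\lambda(t_0)-\lambda^\dagger\in\operatorname{Ran}A$. Assume that there exist $s_T\in[0,s_\infty)$ and $\eta_1,\eta_2>0$ such that for all $s\in[s_T,s_\infty)$: $$ p(s)<2\Bigl(\delta-\frac{\sigma}{\gamma}\Bigr),\qquad \frac{\sigma}{\gamma}-p(s)\ge\eta_1,\qquad \delta-\frac{\sigma}{\gamma}-\frac{p(s)}{2}-\frac{\sigma L}{2\gamma}\beta(t(s))^2\ge\eta_2,\qquad \frac{\sigma}{4\gamma}(-p'(s))_+\le\frac{\sigma/\gamma+p(s)}{8}. $$ Then, as $t\to\infty$, $$ \|\dot x(t)\|=o\bigl(\sqrt{\varepsilon(t)}\bigr),\qquad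 \mathcal{L}(x(t),\lambda^\dagger)-\mathcal{L}(x^*,\lambda^\dagger)=o(\varepsilon(t)), $$ $$ \|Ax(t)-b\|=o(\varepsilon(t)),\qquad |f(x(t))-f(x^* )|=o(\varepsilon(t)). $$
   Context: Standing assumptions: $t_0>0$; $f:\mathbb{R}^n\to\mathbb{R}$ is convex and continuously differentiable with $L$-Lipschitz gradient, $L>0$; $A\in\mathbb{R}^{m\times n}$, $b\in\mathbb{R}^m$; $\delta,\rho,\sigma,\gamma>0$; $\varepsilon\in C^2([t_0,\infty);(0,\infty))$ is nonincreasing with $\varepsilon(t)\to0$ as $t\to\infty$; $\beta:[t_0,\infty)\to[0,\infty)$ is continuous and bounded. The solution set $S:=\operatorname{argmin}\{f(x):Ax=b\}$ is nonempty, and $P_S(0)$ denotes its minimum-norm element. A multiplier $\lambda^\dagger$ with the two stated properties always exists and is unique. The Lagrangian is $\mathcal{L}(x,\lambda):=f(x)+\langle\lambda,Ax-b\rangle$. Time change: $s(t):=\int_{t_0}^t\sqrt{\varepsilon(u)}\,du$, $s_\infty:=\int_{t_0}^\infty\sqrt{\varepsilon(u)}\,du\in(0,\infty]$; $t(s)$ is the inverse of the strictly increasing map $s:[t_0,\infty)\to[0,s_\infty)$; $a(s):=1/\varepsilon(t(s))$; $p(s):=a'(s)/a(s)=-\dot\varepsilon(t(s))/\varepsilon(t(s))^{3/2}$; $p'$ is the derivative of $p$ with respect to $s$. Notation $(r)_+:=\max\{r,0\}$. *)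

theory Defs
  imports "HOL-Analysis.Analysis" "HOL-Library.Landau_Symbols"
begin

definition solution_set ::
    "(real ^ 'n \<Rightarrow> real) \<Rightarrow> real ^ 'n ^ 'm \<Rightarrow> real ^ 'm \<Rightarrow> (real ^ 'n) set" where
  "solution_set f A b = {x. is_arg_min f (\<lambda>z. A *v z = b) x}"

definition lagrangian ::
    "(real ^ 'n \<Rightarrow> real) \<Rightarrow> real ^ 'n ^ 'm \<Rightarrow> real ^ 'm \<Rightarrow> real ^ 'n \<Rightarrow> real ^ 'm \<Rightarrow> real" where
  "lagrangian f A b x lam = f x + lam \<bullet> (A *v x - b)"

definition new_time :: "real \<Rightarrow> (real \<Rightarrow> real) \<Rightarrow> real \<Rightarrow> real" where
  "new_time t0 \<epsilon> t = integral {t0..t} (\<lambda>u. sqrt (\<epsilon> u))"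

definition new_time_end :: "real \<Rightarrow> (real \<Rightarrow> real) \<Rightarrow> ennreal" where
  "new_time_end t0 \<epsilon> = (\<integral>\<^sup>+ u\<in>{t0..}. ennreal (sqrt (\<epsilon> u)) \<partial>lborel)"

text \<open>The half-open interval from 0 to the possibly infinite end of the new time.
  The explicit lower bound is needed because \<^const>\<open>ennreal\<close> truncates negative numbers.\<close>

definition new_times :: "real \<Rightarrow> (real \<Rightarrow> real) \<Rightarrow> real set" where
  "new_times t0 \<epsilon> = {s. 0 \<le> s \<and> ennreal s < new_time_end t0 \<epsilon>}"

definition old_time :: "real \<Rightarrow> (real \<Rightarrow> real) \<Rightarrow> real \<Rightarrow> real" where
  "old_time t0 \<epsilon> = the_inv_into {t0..} (new_time t0 \<epsilon>)"

definition a_fun :: "real \<Rightarrow> (real \<Rightarrow> real) \<Rightarrow> real \<Rightarrow> real" where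
  "a_fun t0 \<epsilon> s = 1 / \<epsilon> (old_time t0 \<epsilon> s)"

text \<open>Derivatives in the new time are taken within \<^const>\<open>new_times\<close>, hence one-sided at 0:
  \<^const>\<open>old_time\<close> is unspecified at negative arguments.\<close>

definition p_fun :: "real \<Rightarrow> (real \<Rightarrow> real) \<Rightarrow> real \<Rightarrow> real" where
  "p_fun t0 \<epsilon> s =
     vector_derivative (a_fun t0 \<epsilon>) (at s within new_times t0 \<epsilon>) / a_fun t0 \<epsilon> s"

definition p_deriv :: "real \<Rightarrow> (real \<Rightarrow> real) \<Rightarrow> real \<Rightarrow> real" where
  "p_deriv t0 \<epsilon> s = vector_derivative (p_fun t0 \<epsilon>) (at s within new_times t0 \<epsilon>)"

end

theory Submission
  imports Defs
begin

text \<open>In the new time the system has a penalty parameter \<open>a = 1 / \<epsilon>\<close> that grows at the rate \<open>p\<close>. With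
  \<open>u = x - x*\<close>, \<open>\<mu> = \<lambda> - \<lambda>\<^sup>\<dagger>\<close>, \<open>\<kappa> = \<sigma> / \<gamma>\<close> and \<open>v\<close> the velocity, the energy consists of
  \<open>\<bar>\<kappa> u + v\<bar>\<^sup>2 / 2\<close>, a multiple of \<open>\<bar>\<mu>\<bar>\<^sup>2\<close>, \<open>a\<close> times the augmented Lagrangian gap,
  \<open>(\<bar>x\<bar>\<^sup>2 - \<bar>x*\<bar>\<^sup>2) / 2\<close> and a multiple of \<open>\<bar>u\<bar>\<^sup>2\<close>. It dissipates everything except \<open>\<mu>\<close>; a
  small cross term \<open>\<langle>A v, \<mu>\<rangle> / a\<close> recovers that part, since the transpose of \<open>A\<close> is bounded below on
  the range of \<open>A\<close>, where \<open>\<mu>\<close> lives. Up to vanishing terms the only forcing is \<open>- \<langle>x*, u\<rangle>\<close>. As \<open>x*\<close> has minimal norm this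
  is nonpositive on the solution set, so that by compactness it is dominated by \<open>a\<close> times the gap up
  to an error that vanishes as \<open>a\<close> grows. The new time being infinite, the energy tends to zero.

  For the residual, \<open>Q = a (A x - b) - (\<sigma> / \<gamma>\<^sup>2) \<mu>\<close> satisfies a linear equation with damping
  \<open>\<kappa> - p\<close> bounded away from zero, forced by \<open>\<mu>\<close> alone, whence \<open>a (A x - b)\<close> vanishes as well.\<close>

section \<open>The change of time\<close>

text \<open>The difference quotient of \<open>g\<close> after the inverse of \<open>N\<close> is
  that of \<open>g\<close> divided by that of \<open>N\<close>, so continuity of the inverse
  suffices to pass to the limit. Derivatives within \<open>{t0..}\<close> cover the endpoint as
  well.\<close>

lemma has_field_derivative_comp_the_inv_into:
  fixes N g :: "real \<Rightarrow> real"
  assumes mono: "strict_mono_on {t0..} N"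
    and N_deriv: "\<And>t. t \<ge> t0 \<Longrightarrow> (N has_real_derivative N' t) (at t within {t0..})"
    and "N' t \<noteq> 0" and "t \<ge> t0"
    and g_deriv: "(g has_real_derivative D) (at t within {t0..})"
  shows "((\<lambda>s. g (the_inv_into {t0..} N s)) has_real_derivative D / N' t)
           (at (N t) within N ` {t0..})"
proof -
  define inv_N where "inv_N = the_inv_into {t0..} N"
  have inj: "inj_on N {t0..}"
    using mono by (rule strict_mono_on_imp_inj_on)
  have ON: "inv_N (N r) = r" if "r \<ge> t0" for r
    unfolding inv_N_def using the_inv_into_f_f[OF inj] that by simp
  have cont: "continuous_on {t0..} N"
    using N_deriv DERIV_continuous_on by (metis atLeast_iff)
  \<comment> \<open>Compactness gives continuity of the inverse; the image of a compact interval
    reaching past \<open>t\<close> is still a relative neighbourhood of \<open>N t\<close>.\<close>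
  let ?I = "{t0..t + 1}"
  have "continuous_on (N ` ?I) inv_N"
    by (rule continuous_on_inv) (auto intro: continuous_on_subset[OF cont] simp: ON)
  moreover have "N ` ?I = N ` {t0..} \<inter> {..N (t + 1)}"
  proof -
    have "N r \<le> N (t + 1) \<longleftrightarrow> r \<le> t + 1" if "r \<ge> t0" for r
      using strict_mono_on_leD[OF mono, of r "t + 1"] strict_mono_onD[OF mono, of "t + 1" r]
        that \<open>t \<ge> t0\<close> by (cases "r \<le> t + 1") (auto simp: not_le)
    then show ?thesis by auto
  qed
  moreover have "N t < N (t + 1)"
    using strict_mono_onD[OF mono, of t "t + 1"] \<open>t \<ge> t0\<close> by simp
  ultimately have "continuous (at (N t) within N ` {t0..} \<inter> {..N (t + 1)}) inv_N"
    using \<open>t \<ge> t0\<close> by (auto simp: continuous_on_eq_continuous_within)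
  moreover have "at (N t) within N ` {t0..} \<inter> {..N (t + 1)} = at (N t) within N ` {t0..}"
    by (rule at_within_nhd[of _ "{..<N (t + 1)}"]) (use \<open>N t < N (t + 1)\<close> in auto)
  ultimately have "(inv_N \<longlongrightarrow> t) (at (N t) within N ` {t0..})"
    using ON \<open>t \<ge> t0\<close> by (simp add: continuous_within)
  moreover have "\<forall>\<^sub>F s in at (N t) within N ` {t0..}. inv_N s \<in> {t0..} \<and> inv_N s \<noteq> t"
    by (auto simp: eventually_at_filter ON intro!: always_eventually)
  ultimately have lim_O: "filterlim inv_N (at t within {t0..}) (at (N t) within N ` {t0..})"
    by (simp add: filterlim_at)
  have "((\<lambda>r. ((g r - g t) / (r - t)) / ((N r - N t) / (r - t))) \<longlongrightarrow> D / N' t)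
          (at t within {t0..})"
    by (intro tendsto_divide) (use g_deriv N_deriv assms in \<open>auto simp: has_field_derivative_iff\<close>)
  then have "((\<lambda>r. (g r - g t) / (N r - N t)) \<longlongrightarrow> D / N' t) (at t within {t0..})"
    by (rule Lim_transform_eventually) (auto simp: eventually_at_filter)
  from filterlim_compose[OF this lim_O]
  have "((\<lambda>s. (g (inv_N s) - g t) / (N (inv_N s) - N t)) \<longlongrightarrow> D / N' t) (at (N t) within N ` {t0..})" .
  then have "((\<lambda>s. (g (inv_N s) - g (inv_N (N t))) / (s - N t)) \<longlongrightarrow> D / N' t) (at (N t) within N ` {t0..})"
    by (rule Lim_transform_eventually)
       (use ON \<open>t \<ge> t0\<close> in \<open>auto simp: eventually_at_filter intro!: always_eventually\<close>)
  then show ?thesis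
    by (simp add: has_field_derivative_iff inv_N_def)
qed

section \<open>The new time, its range, and derivatives taken in it\<close>

context
  fixes t0 :: real and \<epsilon> :: "real \<Rightarrow> real"
  assumes eps_pos: "\<And>t. t \<ge> t0 \<Longrightarrow> \<epsilon> t > 0"
    and eps_cont: "continuous_on {t0..} \<epsilon>"
begin

lemma new_time_deriv:
  assumes "t \<ge> t0"
  shows "(new_time t0 \<epsilon> has_real_derivative sqrt (\<epsilon> t)) (at t within {t0..})"
proof -
  have "((\<lambda>u. integral {t0..u} (\<lambda>u. sqrt (\<epsilon> u))) has_real_derivative sqrt (\<epsilon> t))
          (at t within {t0..t + 1})"
    by (rule integral_has_real_derivative)
       (use assms in \<open>auto intro!: continuous_intros continuous_on_subset[OF eps_cont]\<close>)
  moreover have "at t within {t0..t + 1} = at t within {t0..}"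
    by (rule at_within_nhd[of _ "{..<t + 1}"]) auto
  ultimately show ?thesis
    unfolding new_time_def[abs_def] by simp
qed

lemma new_time_strict_mono: "strict_mono_on {t0..} (new_time t0 \<epsilon>)"
proof (rule strict_mono_onI)
  fix r s assume rs: "r \<in> {t0..}" "s \<in> {t0..}" "r < s"
  show "new_time t0 \<epsilon> r < new_time t0 \<epsilon> s"
  proof (rule DERIV_pos_imp_increasing_open[OF \<open>r < s\<close>])
    fix u assume "r < u" "u < s"
    with rs have "u > t0" by auto
    then show "\<exists>y. (new_time t0 \<epsilon> has_real_derivative y) (at u) \<and> 0 < y"
      using new_time_deriv[of u] eps_pos[of u] at_within_interior[of u "{t0..}"]
      by (intro exI[of _ "sqrt (\<epsilon> u)"]) (simp add: interior_real_atLeast)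
  next
    show "continuous_on {r..s} (new_time t0 \<epsilon>)"
      using rs by (intro continuous_on_subset[OF DERIV_continuous_on[OF new_time_deriv]]) auto
  qed
qed

lemma new_time_t0: "new_time t0 \<epsilon> t0 = 0"
  by (simp add: new_time_def)

lemma new_time_nonneg: "t \<ge> t0 \<Longrightarrow> new_time t0 \<epsilon> t \<ge> 0"
  using strict_mono_on_leD[OF new_time_strict_mono, of t0 t] by (simp add: new_time_t0)

lemma new_time_le_end:
  assumes "t \<ge> t0"
  shows "ennreal (new_time t0 \<epsilon> t) \<le> new_time_end t0 \<epsilon>"
proof -
  have "((\<lambda>u. sqrt (\<epsilon> u)) has_integral new_time t0 \<epsilon> t) {t0..t}"
    unfolding new_time_def
    by (intro integrable_integral integrable_continuous_interval continuous_intros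
          continuous_on_subset[OF eps_cont]) auto
  then have "(\<integral>\<^sup>+ u\<in>{t0..t}. ennreal (sqrt (\<epsilon> u)) \<partial>lborel) = ennreal (new_time t0 \<epsilon> t)"
    using eps_pos by (intro nn_integral_has_integral_lebesgue') (auto intro: less_imp_le)
  moreover have "(\<integral>\<^sup>+ u\<in>{t0..t}. ennreal (sqrt (\<epsilon> u)) \<partial>lborel) \<le> new_time_end t0 \<epsilon>"
    unfolding new_time_end_def by (intro nn_integral_mono) (auto split: split_indicator)
  ultimately show ?thesis by simp
qed

text \<open>By monotone convergence the end of the new time is the supremum of
  \<open>new_time\<close> at the points \<open>t0 + i\<close>; a bound \<open>s\<close> on all of
  these would bound the end too.\<close>

lemma less_end_imp_less_new_time:
  assumes "s \<ge> 0" "ennreal s < new_time_end t0 \<epsilon>"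
  shows "\<exists>t\<ge>t0. s < new_time t0 \<epsilon> t"
proof (rule ccontr)
  assume "\<not> ?thesis"
  then have le: "new_time t0 \<epsilon> t \<le> s" if "t \<ge> t0" for t
    using that by force
  define g where "g = (\<lambda>(i::nat) u. ennreal (indicator {t0..t0 + real i} u *\<^sub>R sqrt (\<epsilon> u)))"
  have g_eq: "g i u = ennreal (sqrt (\<epsilon> u)) * indicator {t0..t0 + real i} u" for i u
    by (auto simp: g_def indicator_def)
  have g_meas: "g i \<in> borel_measurable lborel" for i
  proof -
    have "continuous_on {t0..t0 + real i} (\<lambda>u. sqrt (\<epsilon> u))"
      by (intro continuous_intros continuous_on_subset[OF eps_cont]) auto
    then have "(\<lambda>u. indicator {t0..t0 + real i} u *\<^sub>R sqrt (\<epsilon> u)) \<in> borel_measurable borel"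
      by (intro borel_measurable_continuous_on_indicator) auto
    then show ?thesis
      unfolding g_def by simp
  qed
  have inc: "incseq g"
    by (auto simp: incseq_def le_fun_def g_eq split: split_indicator)
  have sup: "(SUP i. g i u) = ennreal (sqrt (\<epsilon> u)) * indicator {t0..} u" for u
  proof (cases "u \<ge> t0")
    case True
    obtain i :: nat where "u - t0 \<le> real i"
      using real_arch_simple by blast
    then have "g i u = ennreal (sqrt (\<epsilon> u))"
      using True by (simp add: g_eq)
    then show ?thesis
      using True by (intro antisym SUP_least) (auto simp: g_eq split: split_indicator intro: SUP_upper2[of i])
  qed (simp add: g_eq)
  have "(\<integral>\<^sup>+u. g i u \<partial>lborel) \<le> ennreal s" for i
  proof -
    have "((\<lambda>u. sqrt (\<epsilon> u)) has_integral new_time t0 \<epsilon> (t0 + real i)) {t0..t0 + real i}"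
      unfolding new_time_def
      by (intro integrable_integral integrable_continuous_interval continuous_intros
            continuous_on_subset[OF eps_cont]) auto
    then have "(\<integral>\<^sup>+u. g i u \<partial>lborel) = ennreal (new_time t0 \<epsilon> (t0 + real i))"
      unfolding g_eq using eps_pos
      by (intro nn_integral_has_integral_lebesgue') (auto intro: less_imp_le)
    then show ?thesis
      using le by (simp add: ennreal_leI)
  qed
  then have "(SUP i. \<integral>\<^sup>+u. g i u \<partial>lborel) \<le> ennreal s"
    by (rule SUP_least)
  moreover have "(SUP i. \<integral>\<^sup>+u. g i u \<partial>lborel) = new_time_end t0 \<epsilon>"
    unfolding nn_integral_monotone_convergence_SUP[OF inc g_meas, symmetric] sup new_time_end_def ..
  ultimately show False
    using assms(2) by simp
qed

text \<open>Intermediate values give one inclusion. For the other, \<open>new_time\<close> is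
  strictly larger at \<open>t + 1\<close> than at \<open>t\<close>, so that even a finite end is
  never attained.\<close>

lemma new_times_eq: "new_times t0 \<epsilon> = new_time t0 \<epsilon> ` {t0..}"
proof (intro equalityI subsetI)
  fix s assume "s \<in> new_times t0 \<epsilon>"
  then have "s \<ge> 0" and "ennreal s < new_time_end t0 \<epsilon>"
    by (auto simp: new_times_def)
  then obtain t where "t \<ge> t0" "s < new_time t0 \<epsilon> t"
    using less_end_imp_less_new_time by blast
  moreover have "continuous_on {t0..t} (new_time t0 \<epsilon>)"
    by (intro continuous_on_subset[OF DERIV_continuous_on[OF new_time_deriv]]) auto
  ultimately show "s \<in> new_time t0 \<epsilon> ` {t0..}"
    using IVT'[of "new_time t0 \<epsilon>" t0 s t] \<open>s \<ge> 0\<close> by (auto simp: new_time_t0)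
next
  fix s assume "s \<in> new_time t0 \<epsilon> ` {t0..}"
  then obtain t where t: "t \<ge> t0" "s = new_time t0 \<epsilon> t" by auto
  have "new_time t0 \<epsilon> t < new_time t0 \<epsilon> (t + 1)"
    using strict_mono_onD[OF new_time_strict_mono, of t "t + 1"] t by simp
  then have "ennreal s < ennreal (new_time t0 \<epsilon> (t + 1))"
    using t new_time_nonneg[of t] by (simp add: ennreal_lessI)
  also have "\<dots> \<le> new_time_end t0 \<epsilon>"
    using t by (intro new_time_le_end) simp
  finally show "s \<in> new_times t0 \<epsilon>"
    using t new_time_nonneg[of t] by (simp add: new_times_def)
qed

lemma old_time_new_time: "t \<ge> t0 \<Longrightarrow> old_time t0 \<epsilon> (new_time t0 \<epsilon> t) = t"
  unfolding old_time_def
  by (intro the_inv_into_f_f strict_mono_on_imp_inj_on[OF new_time_strict_mono]) simp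

text \<open>\<open>vector_derivative\<close> chooses among derivatives and is determined only at
  limit points of the set. Agreement of \<open>h\<close> with \<open>g\<close> is asked for on
  \<open>new_times\<close> alone, since \<open>old_time\<close> is unspecified elsewhere.\<close>

lemma vector_derivative_comp_old_time:
  assumes "t \<ge> t0" and "(g has_real_derivative D) (at t within {t0..})"
    and "\<And>s. s \<in> new_times t0 \<epsilon> \<Longrightarrow> h s = g (old_time t0 \<epsilon> s)"
  shows "vector_derivative h (at (new_time t0 \<epsilon> t) within new_times t0 \<epsilon>) = D / sqrt (\<epsilon> t)"
proof (rule vector_derivative_within)
  let ?s = "new_time t0 \<epsilon> t"
  \<comment> \<open>A half-open interval to the right of \<open>?s\<close> lies in the set, which
    makes \<open>?s\<close> a limit point even when \<open>t = t0\<close>.\<close>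
  have "{?s..<new_time t0 \<epsilon> (t + 1)} \<subseteq> new_times t0 \<epsilon>"
  proof
    fix s assume s: "s \<in> {?s..<new_time t0 \<epsilon> (t + 1)}"
    then have "ennreal s < ennreal (new_time t0 \<epsilon> (t + 1))"
      using assms(1) new_time_nonneg[of t] by (intro ennreal_lessI) auto
    also have "\<dots> \<le> new_time_end t0 \<epsilon>"
      using assms(1) by (intro new_time_le_end) simp
    finally show "s \<in> new_times t0 \<epsilon>"
      using s assms(1) new_time_nonneg[of t] by (simp add: new_times_def)
  qed
  moreover have "?s < new_time t0 \<epsilon> (t + 1)"
    using strict_mono_onD[OF new_time_strict_mono, of t "t + 1"] assms(1) by simp
  ultimately have "?s islimpt new_times t0 \<epsilon>"
    using islimpt_subset[of ?s "{?s..<new_time t0 \<epsilon> (t + 1)}"] by (simp add: islimpt_Ico)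
  then show "at ?s within new_times t0 \<epsilon> \<noteq> bot"
    by (simp add: trivial_limit_within)
next
  have "((\<lambda>s. g (old_time t0 \<epsilon> s)) has_real_derivative D / sqrt (\<epsilon> t))
          (at (new_time t0 \<epsilon> t) within new_times t0 \<epsilon>)"
    unfolding new_times_eq old_time_def
    by (rule has_field_derivative_comp_the_inv_into)
       (use assms eps_pos[of t] new_time_strict_mono new_time_deriv in auto)
  then have "(h has_real_derivative D / sqrt (\<epsilon> t))
          (at (new_time t0 \<epsilon> t) within new_times t0 \<epsilon>)"
    by (rule has_field_derivative_transform_within[OF _ zero_less_one])
       (use assms(1) in \<open>simp_all add: assms(3) new_times_eq\<close>)
  then show "(h has_vector_derivative D / sqrt (\<epsilon> t))
          (at (new_time t0 \<epsilon> t) within new_times t0 \<epsilon>)"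
    by (simp add: has_real_derivative_iff_has_vector_derivative)
qed

lemma p_fun_new_time:
  assumes "t \<ge> t0" and "(\<epsilon> has_real_derivative D) (at t within {t0..})"
  shows "p_fun t0 \<epsilon> (new_time t0 \<epsilon> t) = - D / sqrt (\<epsilon> t) ^ 3"
proof -
  have "((\<lambda>t. 1 / \<epsilon> t) has_real_derivative - D / (\<epsilon> t)\<^sup>2) (at t within {t0..})"
    using assms(2) eps_pos[OF assms(1)]
    by (auto intro!: derivative_eq_intros simp: power2_eq_square)
  then have "vector_derivative (a_fun t0 \<epsilon>) (at (new_time t0 \<epsilon> t) within new_times t0 \<epsilon>)
      = - D / (\<epsilon> t)\<^sup>2 / sqrt (\<epsilon> t)"
    by (rule vector_derivative_comp_old_time[OF assms(1)]) (simp add: a_fun_def)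
  moreover have "\<epsilon> t = sqrt (\<epsilon> t) ^ 2"
    using eps_pos[OF assms(1)] by simp
  ultimately show ?thesis
    using eps_pos[OF assms(1)] assms(1)
    by (simp add: p_fun_def a_fun_def old_time_new_time field_simps power2_eq_square
        power3_eq_cube)
qed

lemma p_deriv_new_time:
  assumes "t \<ge> t0" and eps_deriv: "\<And>t. t \<ge> t0 \<Longrightarrow> (\<epsilon> has_real_derivative \<epsilon>' t) (at t within {t0..})"
    and D: "((\<lambda>t. - \<epsilon>' t / sqrt (\<epsilon> t) ^ 3) has_real_derivative D) (at t within {t0..})"
  shows "p_deriv t0 \<epsilon> (new_time t0 \<epsilon> t) = D / sqrt (\<epsilon> t)"
  unfolding p_deriv_def
proof (rule vector_derivative_comp_old_time[OF assms(1) D])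
  fix s assume "s \<in> new_times t0 \<epsilon>"
  then obtain r where "r \<ge> t0" "s = new_time t0 \<epsilon> r"
    by (auto simp: new_times_eq)
  then show "p_fun t0 \<epsilon> s = - \<epsilon>' (old_time t0 \<epsilon> s) / sqrt (\<epsilon> (old_time t0 \<epsilon> s)) ^ 3"
    by (simp add: p_fun_new_time[OF _ eps_deriv] old_time_new_time)
qed

end

section \<open>Convex problems with linear constraints\<close>

lemma GDERIV_along_line:
  fixes f :: "'a::real_inner \<Rightarrow> real"
  assumes "GDERIV f (x + t *\<^sub>R d) :> g"
  shows "((\<lambda>t::real. f (x + t *\<^sub>R d)) has_real_derivative g \<bullet> d) (at t)"
proof -
  have "((\<lambda>t::real. x + t *\<^sub>R d) has_derivative (\<lambda>t. t *\<^sub>R d)) (at t)"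
    by (auto intro!: derivative_eq_intros)
  moreover have "(f has_derivative (\<lambda>h. h \<bullet> g)) (at (x + t *\<^sub>R d))"
    using assms by (simp add: gderiv_def)
  ultimately have "((\<lambda>t. f (x + t *\<^sub>R d)) has_derivative (\<lambda>t. (t *\<^sub>R d) \<bullet> g)) (at t)"
    by (rule has_derivative_compose)
  then show ?thesis
    by (simp add: has_field_derivative_def inner_commute mult_commute_abs)
qed

text \<open>Restriction to the line through \<open>x\<close> and \<open>y\<close> leaves a convex
  function of one real variable, which lies above its tangent.\<close>

lemma convex_GDERIV_above_tangent:
  fixes f :: "'a::real_inner \<Rightarrow> real"
  assumes "convex_on UNIV f" and "GDERIV f x :> g"
  shows "f x + g \<bullet> (y - x) \<le> f y"
proof -
  define h where "h t = f (x + t *\<^sub>R (y - x))" for t :: real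
  have "convex_on UNIV h"
  proof (rule convex_onI)
    fix t r s :: real assume t: "0 < t" "t < 1"
    have "x + ((1 - t) * r + t * s) *\<^sub>R (y - x)
        = (1 - t) *\<^sub>R (x + r *\<^sub>R (y - x)) + t *\<^sub>R (x + s *\<^sub>R (y - x))"
      by (simp add: algebra_simps)
    then show "h ((1 - t) *\<^sub>R r + t *\<^sub>R s) \<le> (1 - t) * h r + t * h s"
      using convex_onD[OF assms(1), of t] t by (simp add: h_def)
  qed simp
  moreover have "(h has_real_derivative g \<bullet> (y - x)) (at 0 within UNIV)"
    using GDERIV_along_line[of f x 0 "y - x" g] assms(2) by (simp add: h_def[abs_def])
  ultimately have "h 1 - h 0 \<ge> (g \<bullet> (y - x)) * (1 - 0)"
    by (intro convex_on_imp_above_tangent[where A = UNIV]) auto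
  then show ?thesis by (simp add: h_def)
qed

lemma GDERIV_continuous_on:
  assumes "\<And>z. GDERIV f z :> grad z"
  shows "continuous_on X f"
proof -
  have "(f has_derivative (\<lambda>h. h \<bullet> grad z)) (at z within X)" for z
    using assms[of z] unfolding gderiv_def by (rule has_derivative_at_withinI)
  then show ?thesis
    by (intro has_derivative_continuous_on) auto
qed

text \<open>Along the segment, \<open>f\<close> minus its linearisation minus the quadratic term has
  nonpositive derivative, by the Lipschitz bound and Cauchy-Schwarz.\<close>

lemma lipschitz_GDERIV_descent:
  fixes f :: "'a::real_inner \<Rightarrow> real"
  assumes f_grad: "\<And>z. GDERIV f z :> grad z" and lip: "L-lipschitz_on UNIV grad"
  shows "f y \<le> f x + grad x \<bullet> (y - x) + L / 2 * (norm (y - x))\<^sup>2"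
proof -
  define d where "d = y - x"
  define h where "h t = f (x + t *\<^sub>R d) - t * (grad x \<bullet> d) - t\<^sup>2 * (L / 2 * (norm d)\<^sup>2)" for t :: real
  have "h 1 \<le> h 0"
  proof (rule DERIV_nonpos_imp_nonincreasing[where f = h])
    fix t :: real assume t: "0 \<le> t" "t \<le> 1"
    have "(h has_real_derivative
        grad (x + t *\<^sub>R d) \<bullet> d - grad x \<bullet> d - 2 * t * (L / 2 * (norm d)\<^sup>2)) (at t)"
      unfolding h_def by (auto intro!: derivative_eq_intros GDERIV_along_line f_grad)
    moreover have "(grad (x + t *\<^sub>R d) - grad x) \<bullet> d \<le> L * (t * norm d) * norm d"
    proof -
      have "norm (grad (x + t *\<^sub>R d) - grad x) \<le> L * (t * norm d)"
        using lipschitz_onD[OF lip, of "x + t *\<^sub>R d" x] t by (simp add: dist_norm)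
      then show ?thesis
        using norm_cauchy_schwarz[of "grad (x + t *\<^sub>R d) - grad x" d]
        by (meson mult_right_mono norm_ge_zero order_trans)
    qed
    ultimately show "\<exists>y. (h has_real_derivative y) (at t) \<and> y \<le> 0"
      by (intro exI[of _ "grad (x + t *\<^sub>R d) \<bullet> d - grad x \<bullet> d - 2 * t * (L / 2 * (norm d)\<^sup>2)"])
         (simp add: inner_diff_left power2_eq_square mult_ac)
  qed simp
  then show ?thesis
    by (simp add: h_def d_def)
qed

text \<open>Minimality of the norm enters as \<open>min_norm\<close>, the variational inequality of
  the projection of 0 onto the solution set.\<close>

locale linearly_constrained_problem =
  fixes f :: "real ^ 'n \<Rightarrow> real" and grad :: "real ^ 'n \<Rightarrow> real ^ 'n"
    and A :: "real ^ 'n ^ 'm" and b :: "real ^ 'm" and L :: real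
    and xs :: "real ^ 'n" and ld :: "real ^ 'm"
  assumes f_convex: "convex_on UNIV f"
    and f_grad: "\<And>z. GDERIV f z :> grad z"
    and lip: "L-lipschitz_on UNIV grad"
    and stationary: "grad xs + transpose A *v ld = 0"
    and feasible: "A *v xs = b"
    and min_norm: "\<And>y. A *v y = b \<Longrightarrow> f y \<le> f xs \<Longrightarrow> 0 \<le> xs \<bullet> (y - xs)"
begin

definition gap where "gap y = lagrangian f A b y ld - lagrangian f A b xs ld"

text \<open>Stationarity turns the constraint term into the gradient at \<open>xs\<close>: the gap
  is the Bregman distance of \<open>f\<close> from \<open>xs\<close>.\<close>

lemma gap_eq: "gap y = f y - f xs - grad xs \<bullet> (y - xs)"
proof -
  have "grad xs = - (transpose A *v ld)"
    using stationary by (simp add: eq_neg_iff_add_eq_0)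
  then show ?thesis
    by (simp add: gap_def lagrangian_def dot_lmul_matrix matrix_vector_mult_diff_distrib feasible)
qed

lemma gap_nonneg: "gap y \<ge> 0"
  using convex_GDERIV_above_tangent[OF f_convex f_grad, of xs y] by (simp add: gap_eq)

lemma grad_monotone: "0 \<le> (grad z - grad y) \<bullet> (z - y)"
  using convex_GDERIV_above_tangent[OF f_convex f_grad, of y z]
    convex_GDERIV_above_tangent[OF f_convex f_grad, of z y]
  by (simp add: inner_diff_left inner_diff_right)

text \<open>The descent inequality from \<open>z\<close> to \<open>y\<close> is added to the tangent
  inequality at \<open>z\<close> evaluated at \<open>xs\<close>. It serves with \<open>z\<close> the
  extrapolated point at which the system evaluates the gradient.\<close>

lemma gap_le: "gap y \<le> (grad z - grad xs) \<bullet> (y - xs) + L / 2 * (norm (y - z))\<^sup>2"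
  using convex_GDERIV_above_tangent[OF f_convex f_grad, of z xs]
    lipschitz_GDERIV_descent[OF f_grad lip, of y z]
  by (simp add: gap_eq inner_diff_left inner_diff_right)

lemma norm_grad_diff_le: "norm (grad z - grad y) \<le> L * norm (z - y)"
  using lipschitz_onD[OF lip, of z y] by (simp add: dist_norm)

lemma continuous_gap: "continuous_on X gap"
proof -
  have "continuous_on X f"
    using f_grad by (rule GDERIV_continuous_on)
  then show ?thesis
    unfolding gap_eq[abs_def] by (intro continuous_intros)
qed

text \<open>The possibly negative linear term is nonnegative on the solution set, off which the
  penalty blows up; this replaces any quantitative bound on the Tikhonov path.\<close>

lemma penalty_lower_bound:
  assumes "c1 > 0" "c2 > 0" "q > 0" "\<tau> > 0" "C \<ge> 0"
  shows "\<exists>a0>0. \<forall>a\<ge>a0. \<forall>y.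
    - \<tau> \<le> a * (c1 * gap y + c2 * (norm (A *v y - b))\<^sup>2) + q * (norm (y - xs))\<^sup>2 + C * (xs \<bullet> (y - xs))"
proof -
  define G where "G y = c1 * gap y + c2 * (norm (A *v y - b))\<^sup>2" for y
  define H where "H y = q * (norm (y - xs))\<^sup>2 + C * (xs \<bullet> (y - xs))" for y
  have G0: "G y \<ge> 0" for y
    using assms gap_nonneg[of y] by (simp add: G_def)
  \<comment> \<open>\<open>- M\<close> is a crude lower bound of \<open>H\<close>.\<close>
  define M where "M = C\<^sup>2 * (norm xs)\<^sup>2 / q"
  \<comment> \<open>Off \<open>K\<close> there is nothing to prove, since \<open>G\<close> is
    nonnegative; the quadratic growth of \<open>H\<close> makes \<open>K\<close> bounded.\<close>
  define K where "K = {y. H y \<le> - \<tau>}"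
  have H_ge: "H y \<ge> q * norm (y - xs) * (norm (y - xs) - \<bar>C\<bar> * norm xs / q)" for y
  proof -
    have "\<bar>C * (xs \<bullet> (y - xs))\<bar> \<le> \<bar>C\<bar> * (norm xs * norm (y - xs))"
      unfolding abs_mult by (intro mult_left_mono Cauchy_Schwarz_ineq2) auto
    then show ?thesis
      using \<open>q > 0\<close> by (simp add: H_def power2_eq_square algebra_simps abs_le_iff)
  qed
  have H_lower: "H y \<ge> - M" for y
  proof -
    have "- (X\<^sup>2) \<le> n * (n - X)" for n X :: real
    proof -
      have "n * (n - X) + X\<^sup>2 = (n - X / 2)\<^sup>2 + 3 / 4 * X\<^sup>2"
        by (simp add: power2_eq_square field_simps)
      also have "\<dots> \<ge> 0" by simp
      finally show ?thesis by simp
    qed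
    from this[of "\<bar>C\<bar> * norm xs / q" "norm (y - xs)"]
    have "q * (norm (y - xs) * (norm (y - xs) - \<bar>C\<bar> * norm xs / q)) \<ge> q * - ((\<bar>C\<bar> * norm xs / q)\<^sup>2)"
      using \<open>q > 0\<close> by (intro mult_left_mono) auto
    moreover have "q * - ((\<bar>C\<bar> * norm xs / q)\<^sup>2) = - M"
      using \<open>q > 0\<close> by (simp add: M_def power2_eq_square power_mult_distrib)
    ultimately show ?thesis
      using H_ge[of y] by (simp add: mult.assoc)
  qed
  have contG: "continuous_on X G" for X
    unfolding G_def by (intro continuous_intros continuous_gap)
  have "compact K"
  proof -
    have "y \<in> cball xs (\<bar>C\<bar> * norm xs / q)" if "y \<in> K" for y
    proof (rule ccontr)
      assume "y \<notin> cball xs (\<bar>C\<bar> * norm xs / q)"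
      then have "norm (y - xs) > \<bar>C\<bar> * norm xs / q"
        by (simp add: dist_norm norm_minus_commute)
      then have "H y \<ge> 0"
        using H_ge[of y] \<open>q > 0\<close> by (smt (verit) mult_nonneg_nonneg norm_ge_zero)
      then show False
        using that \<open>\<tau> > 0\<close> by (simp add: K_def)
    qed
    then have "bounded K"
      by (meson bounded_cball bounded_subset subsetI)
    moreover have "closed K"
      unfolding K_def H_def by (intro closed_Collect_le continuous_intros)
    ultimately show ?thesis
      by (simp add: compact_eq_bounded_closed)
  qed
  \<comment> \<open>A zero of \<open>G\<close> is feasible with the value \<open>f xs\<close>; there
    the variational inequality gives \<open>H\<close> a nonnegative value, which excludes the point
    from \<open>K\<close>.\<close>
  have G_pos: "G y > 0" if "y \<in> K" for y
  proof (rule ccontr)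
    assume "\<not> G y > 0"
    then have "G y = 0" using G0[of y] by simp
    then have "gap y = 0" "A *v y = b"
      using assms gap_nonneg[of y]
      by (auto simp: G_def add_nonneg_eq_0_iff)
    then have "0 \<le> xs \<bullet> (y - xs)"
      by (intro min_norm) (auto simp: gap_def lagrangian_def feasible)
    then have "H y \<ge> 0"
      using assms by (simp add: H_def)
    then show False
      using that \<open>\<tau> > 0\<close> by (simp add: K_def)
  qed
  obtain m where "m > 0" and m: "\<And>y. y \<in> K \<Longrightarrow> G y \<ge> m"
  proof (cases "K = {}")
    case False
    then obtain y0 where "y0 \<in> K" "\<And>y. y \<in> K \<Longrightarrow> G y0 \<le> G y"
      using continuous_attains_inf[OF \<open>compact K\<close> _ contG] by blast
    then show ?thesis
      using that[of "G y0"] G_pos by blast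
  qed (use that[of 1] in auto)
  \<comment> \<open>On \<open>K\<close> the penalty is at least \<open>a * m\<close>, and this
    choice lifts it above the worst value \<open>M\<close> of \<open>- H\<close>; the added 1 keeps
    \<open>a0\<close> positive.\<close>
  define a0 where "a0 = (M + 1) / m"
  have "M \<ge> 0" using \<open>q > 0\<close> by (simp add: M_def)
  have "- \<tau> \<le> a * G y + H y" if "a \<ge> a0" for a y
  proof (cases "y \<in> K")
    case True
    have "a0 > 0"
      using \<open>M \<ge> 0\<close> \<open>m > 0\<close> by (simp add: a0_def)
    then have "M \<le> a * G y"
      using mult_mono[OF that m[OF True]] that \<open>m > 0\<close> by (simp add: a0_def)
    then show ?thesis
      using H_lower[of y] \<open>\<tau> > 0\<close> by simp
  next
    case False
    have "a0 > 0"
      using \<open>M \<ge> 0\<close> \<open>m > 0\<close> by (simp add: a0_def)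
    then have "0 \<le> a * G y"
      using that G0[of y] by simp
    then show ?thesis
      using False by (simp add: K_def)
  qed
  moreover have "a0 > 0"
    using \<open>M \<ge> 0\<close> \<open>m > 0\<close> by (simp add: a0_def)
  ultimately show ?thesis
    unfolding G_def H_def by (intro exI[of _ a0]) (simp add: add.assoc)
qed

end

section \<open>Dissipation of the energy\<close>

text \<open>Measured in the clock \<open>E\<close>, \<open>V\<close> decays at rate \<open>c\<close>
  up to an arbitrarily small forcing, and the clock runs to infinity; so the upper limit of
  \<open>V\<close> is at most 0. \<open>V\<close> itself may be negative.\<close>

lemma gronwall_limsup_nonpos:
  fixes V E :: "real \<Rightarrow> real"
  assumes "c > 0" and E_lim: "filterlim E at_top at_top"
    and E_deriv: "\<And>t. t \<ge> T \<Longrightarrow> (E has_real_derivative e t) (at t)"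
    and V_deriv: "\<And>t. t \<ge> T \<Longrightarrow> (V has_real_derivative V' t) (at t)"
    and decay: "\<And>\<tau>. \<tau> > 0 \<Longrightarrow> \<forall>\<^sub>F t in at_top. V' t \<le> e t * (\<tau> - c * V t)"
    and "\<tau> > 0"
  shows "\<forall>\<^sub>F t in at_top. V t < \<tau>"
proof -
  \<comment> \<open>Half of the target: the forcing \<open>c * m\<close> makes \<open>m\<close> the
    equilibrium of the comparison equation, and the other half absorbs the transient.\<close>
  define m where "m = \<tau> / 2"
  have "m > 0" using \<open>\<tau> > 0\<close> by (simp add: m_def)
  then obtain T1 where T1: "\<And>t. t \<ge> T1 \<Longrightarrow> V' t \<le> e t * (c * m - c * V t)"
    using decay[of "c * m"] \<open>c > 0\<close> by (auto simp: eventually_at_top_linorder)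
  define T2 where "T2 = max T T1"
  \<comment> \<open>The excess over the equilibrium times the integrating factor, nonincreasing from
    \<open>T2\<close> on.\<close>
  define W where "W t = (V t - m) * exp (c * E t)" for t
  have W_mono: "W t \<le> W T2" if "t \<ge> T2" for t
  proof (rule DERIV_nonpos_imp_nonincreasing[where f = W, OF that])
    fix s assume "T2 \<le> s" "s \<le> t"
    then have s: "s \<ge> T" "s \<ge> T1" by (auto simp: T2_def)
    have "(W has_real_derivative (V' s + c * e s * (V s - m)) * exp (c * E s)) (at s)"
      unfolding W_def
      by (rule derivative_eq_intros E_deriv V_deriv s refl | simp add: algebra_simps)+
    moreover have "V' s + c * e s * (V s - m) \<le> 0"
      using T1[OF s(2)] by (simp add: algebra_simps)
    ultimately show "\<exists>y. (W has_real_derivative y) (at s) \<and> y \<le> 0"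
      by (meson exp_ge_zero mult_nonpos_nonneg)
  qed
  have "((\<lambda>t. W T2 * exp (- (c * E t))) \<longlongrightarrow> W T2 * 0) at_top"
    using \<open>c > 0\<close> E_lim
    by (intro tendsto_mult_left filterlim_compose[OF exp_at_bot] filterlim_uminus_at_top[THEN iffD1]
        filterlim_tendsto_pos_mult_at_top[of "\<lambda>_. c" c] tendsto_const) simp_all
  then have "\<forall>\<^sub>F t in at_top. W T2 * exp (- (c * E t)) < m"
    using \<open>m > 0\<close> by (simp add: order_tendstoD)
  then show ?thesis
    using eventually_ge_at_top[of T2]
  proof eventually_elim
    case (elim t)
    have "V t - m = W t * exp (- (c * E t))"
      by (simp add: W_def exp_minus)
    also have "\<dots> \<le> W T2 * exp (- (c * E t))"
      using W_mono[OF elim(2)] by (intro mult_right_mono) auto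
    finally show ?case
      using elim(1) by (simp add: m_def)
  qed
qed

text \<open>If \<open>transpose A\<close> kills \<open>A *v z\<close>, then \<open>A *v z\<close> is
  orthogonal to itself. So the transpose is injective on a subspace of finite dimension, hence
  bounded below there.\<close>

lemma transpose_bounded_below_on_range:
  fixes A :: "real ^ 'n ^ 'm"
  shows "\<exists>k>0. \<forall>q \<in> range ((*v) A). k * norm q \<le> norm (transpose A *v q)"
proof (rule injective_imp_isometric)
  show "subspace (range ((*v) A))"
    by (intro linear_subspace_image matrix_vector_mul_linear subspace_UNIV)
  then show "closed (range ((*v) A))"
    by (rule closed_subspace)
  show "bounded_linear ((*v) (transpose A))"
    by (rule matrix_vector_mul_bounded_linear)
  show "\<forall>q\<in>range ((*v) A). transpose A *v q = 0 \<longrightarrow> q = 0"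
  proof clarsimp
    fix z assume "(A *v z) v* A = 0"
    then have "(A *v z) \<bullet> (A *v z) = 0"
      by (simp add: dot_lmul_matrix[symmetric])
    then show "A *v z = 0" by simp
  qed
qed

lemma inner_transpose: "y \<bullet> (transpose A *v q) = (A *v y) \<bullet> (q :: real ^ 'm)"
  for A :: "real ^ 'n ^ 'm"
  by (metis dot_lmul_matrix inner_commute transpose_matrix_vector)

context linearly_constrained_problem
begin

lemma L_nonneg: "L \<ge> 0"
  using lip by (rule lipschitz_on_nonneg)

lemma GDERIV_gap: "GDERIV gap y :> grad y - grad xs"
proof -
  have "GDERIV (\<lambda>y. f y - f xs - grad xs \<bullet> (y - xs)) y :> grad y - grad xs"
    unfolding gderiv_def
    by (rule derivative_eq_intros f_grad[unfolded gderiv_def] refl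
        | simp add: inner_diff_right inner_commute)+
  then show ?thesis
    by (simp add: gap_eq[abs_def])
qed

text \<open>The second derivative in the new time according to the first equation, where \<open>e\<close> is the square
  root of \<open>\<epsilon>\<close>, \<open>\<theta> = \<beta> e\<close>, and \<open>v\<close>, \<open>\<mu>\<close> are the velocity in the new time and the multiplier error.\<close>

definition accel where
  "accel \<delta> \<rho> e p \<theta> y v \<mu> = - (\<delta> - p / 2) *\<^sub>R v
     - (1 / e\<^sup>2) *\<^sub>R (grad (y + \<theta> *\<^sub>R v) - grad xs + transpose A *v \<mu>
        + \<rho> *\<^sub>R (transpose A *v (A *v (y - xs) + \<theta> *\<^sub>R (A *v v)))) - y"

lemma inner_accel:
  "w \<bullet> accel \<delta> \<rho> e p \<theta> y v \<mu> = - (\<delta> - p / 2) * (w \<bullet> v)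
     - (1 / e\<^sup>2) * (w \<bullet> (grad (y + \<theta> *\<^sub>R v) - grad xs) + (A *v w) \<bullet> \<mu>
        + \<rho> * ((A *v w) \<bullet> (A *v (y - xs)) + \<theta> * ((A *v w) \<bullet> (A *v v)))) - w \<bullet> y"
  unfolding accel_def
  by (simp del: transpose_matrix_vector add: inner_transpose inner_diff_right inner_add_right)

text \<open>The derivative of the energy without the cross term between velocity and multiplier:
  the multiplier drops out and the velocity terms combine with the derivative of the penalty.\<close>

lemma energy_dissipation:
  fixes y v :: "real ^ 'n" and e :: real
  assumes "e > 0" "0 \<le> \<beta>" "0 < \<kappa>" "0 < \<rho>" "0 \<le> p"
    and \<kappa>p: "\<kappa> - p \<ge> \<eta>1" "\<eta>1 > 0" and \<beta>: "\<kappa> * (\<beta> * e) \<le> 1"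
    and d: "\<delta> - \<kappa> - p / 2 - \<kappa> * L / 2 * \<beta>\<^sup>2 \<ge> \<eta>2"
    and p': "\<kappa> / 4 * max (- p') 0 \<le> (\<kappa> + p) / 8"
  defines "a \<equiv> 1 / e\<^sup>2" and "u \<equiv> y - xs"
  shows "(\<kappa> *\<^sub>R u + v) \<bullet> (\<kappa> *\<^sub>R v + accel \<delta> \<rho> e p (\<beta> * e) y v \<mu>)
      + a * (\<mu> \<bullet> (A *v (\<kappa> *\<^sub>R u + v)))
      + a * (p * gap y + (grad y - grad xs) \<bullet> v)
      + \<rho> * a * (p / 2 * (norm (A *v u))\<^sup>2 + (A *v u) \<bullet> (A *v v))
      + y \<bullet> v
      + \<kappa> * ((\<delta> - \<kappa> - p / 2) * (u \<bullet> v) - p' / 4 * (norm u)\<^sup>2)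
    \<le> - \<eta>1 * (a * gap y) - \<rho> * \<kappa> / 4 * (a * (norm (A *v u))\<^sup>2) - \<eta>2 * (norm v)\<^sup>2
       - 3 * \<kappa> / 4 * (norm u)\<^sup>2 - \<kappa> * (xs \<bullet> u)"
    (is "?M \<le> ?R")
proof -
  define \<theta> where "\<theta> = \<beta> * e"
  define gz where "gz = grad (y + \<theta> *\<^sub>R v) - grad xs"
  define gy where "gy = grad y - grad xs"
  define r where "r = A *v u"
  define q where "q = A *v v"
  have a: "a > 0" "a * e\<^sup>2 = 1" using \<open>e > 0\<close> by (auto simp: a_def)
  have \<theta>: "\<theta> \<ge> 0" "\<kappa> * \<theta> \<le> 1" using assms by (auto simp: \<theta>_def)
  have "(\<kappa> *\<^sub>R u + v) \<bullet> (\<kappa> *\<^sub>R v + accel \<delta> \<rho> e p \<theta> y v \<mu>) =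
      - (\<delta> - \<kappa> - p / 2) * ((\<kappa> *\<^sub>R u + v) \<bullet> v)
      - a * ((\<kappa> *\<^sub>R u + v) \<bullet> gz + (\<kappa> *\<^sub>R r + q) \<bullet> \<mu>
        + \<rho> * ((\<kappa> *\<^sub>R r + q) \<bullet> r + \<theta> * ((\<kappa> *\<^sub>R r + q) \<bullet> q))) - (\<kappa> *\<^sub>R u + v) \<bullet> y"
    unfolding inner_add_right[of _ "\<kappa> *\<^sub>R v"] inner_accel gz_def[symmetric] u_def[symmetric]
      matrix_vector_right_distrib matrix_vector_mult_scaleR r_def[symmetric] q_def[symmetric] a_def
    by (simp add: algebra_simps)
  \<comment> \<open>The products with \<open>\<mu>\<close>, \<open>y \<bullet> v\<close>,
    \<open>u \<bullet> v\<close> and the part of \<open>r \<bullet> q\<close> without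
    \<open>\<theta>\<close> cancel; along \<open>v\<close>, only the difference of the two gradients
    is left.\<close>
  then have "?M = - (\<delta> - \<kappa> - p / 2) * (norm v)\<^sup>2 - a * \<kappa> * (gz \<bullet> u) - a * ((gz - gy) \<bullet> v)
      - a * \<rho> * (\<kappa> * (norm r)\<^sup>2 + \<kappa> * \<theta> * (r \<bullet> q) + \<theta> * (norm q)\<^sup>2) - \<kappa> * (u \<bullet> y)
      + p * a * gap y + p * a * \<rho> / 2 * (norm r)\<^sup>2 - \<kappa> * p' / 4 * (norm u)\<^sup>2"
    unfolding \<theta>_def[symmetric] gy_def[symmetric] power2_norm_eq_inner
      matrix_vector_right_distrib matrix_vector_mult_scaleR r_def[symmetric] q_def[symmetric]
    by (simp add: inner_commute inner_add_left inner_add_right inner_diff_left inner_diff_right algebra_simps)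
  \<comment> \<open>Monotonicity of the gradient between points that differ by
    \<open>\<theta> *\<^sub>R v\<close>, divided by \<open>\<theta>\<close>; for
    \<open>\<theta> = 0\<close> the points coincide.\<close>
  moreover have "(gz - gy) \<bullet> v \<ge> 0"
  proof (cases "\<theta> = 0")
    case False
    have "0 \<le> \<theta> * ((gz - gy) \<bullet> v)"
      using grad_monotone[of "y + \<theta> *\<^sub>R v" y] by (simp add: gz_def gy_def)
    then show ?thesis
      using False \<theta> by (simp add: zero_le_mult_iff)
  qed (simp add: gz_def gy_def)
  \<comment> \<open>The extrapolation error in \<open>gap_le\<close> carries
    \<open>\<theta>\<^sup>2\<close>, and \<open>a * \<theta>\<^sup>2 = \<beta>\<^sup>2\<close>; the
    resulting multiple of \<open>(norm v)\<^sup>2\<close> is the one subtracted in hypothesis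
    \<open>d\<close>.\<close>
  moreover have "a * \<kappa> * (gz \<bullet> u) \<ge> \<kappa> * (a * gap y) - \<kappa> * L / 2 * \<beta>\<^sup>2 * (norm v)\<^sup>2"
  proof -
    have "gap y - L / 2 * (\<theta>\<^sup>2 * (norm v)\<^sup>2) \<le> gz \<bullet> u"
      using gap_le[of y "y + \<theta> *\<^sub>R v"] by (simp add: gz_def u_def power_mult_distrib)
    then have "a * \<kappa> * (gap y - L / 2 * (\<theta>\<^sup>2 * (norm v)\<^sup>2)) \<le> a * \<kappa> * (gz \<bullet> u)"
      using a \<open>0 < \<kappa>\<close> by (intro mult_left_mono) auto
    moreover have "a * \<kappa> * (L / 2 * (\<theta>\<^sup>2 * (norm v)\<^sup>2)) = \<kappa> * L / 2 * (\<beta>\<^sup>2 * (a * e\<^sup>2)) * (norm v)\<^sup>2"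
      by (simp add: \<theta>_def power_mult_distrib)
    ultimately show ?thesis
      unfolding a(2) by (simp only: right_diff_distrib mult_1_right mult_ac)
  qed
  \<comment> \<open>Completing the square in \<open>q + (\<kappa> / 2) *\<^sub>R r\<close> gives
    away only a quarter of \<open>\<kappa>\<close>, because \<open>\<kappa> * \<theta>\<close> is at
    most 1.\<close>
  moreover have "a * \<rho> * (\<kappa> * (norm r)\<^sup>2 + \<kappa> * \<theta> * (r \<bullet> q) + \<theta> * (norm q)\<^sup>2)
      \<ge> a * \<rho> * (3 * \<kappa> / 4 * (norm r)\<^sup>2)"
  proof (rule mult_left_mono)
    have "0 \<le> \<theta> * (norm (q + (\<kappa> / 2) *\<^sub>R r))\<^sup>2"
      using \<theta> by simp
    also have "\<dots> = \<theta> * (norm q)\<^sup>2 + \<kappa> * \<theta> * (r \<bullet> q) + \<kappa> * \<theta> * (\<kappa> / 4 * (norm r)\<^sup>2)"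
      by (simp add: power2_norm_eq_inner inner_add_left inner_add_right inner_commute algebra_simps)
    also have "\<kappa> * \<theta> * (\<kappa> / 4 * (norm r)\<^sup>2) \<le> 1 * (\<kappa> / 4 * (norm r)\<^sup>2)"
      using \<theta> \<open>0 < \<kappa>\<close> by (intro mult_right_mono) auto
    finally show "3 * \<kappa> / 4 * (norm r)\<^sup>2 \<le> \<kappa> * (norm r)\<^sup>2 + \<kappa> * \<theta> * (r \<bullet> q) + \<theta> * (norm q)\<^sup>2"
      by simp
  qed (use a assms in auto)
  \<comment> \<open>The growth of the penalty costs another half of \<open>\<kappa>\<close>, which
    leaves the quarter in the conclusion.\<close>
  moreover have "p * a * \<rho> / 2 * (norm r)\<^sup>2 \<le> \<kappa> * a * \<rho> / 2 * (norm r)\<^sup>2"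
    using a assms by (intro mult_right_mono divide_right_mono) auto
  \<comment> \<open>As \<open>p\<close> is at most \<open>\<kappa>\<close>, the bound in
    \<open>p'\<close> is at most \<open>\<kappa> / 4\<close>.\<close>
  moreover have "- (\<kappa> * p' / 4) * (norm u)\<^sup>2 \<le> \<kappa> / 4 * (norm u)\<^sup>2"
  proof (rule mult_right_mono)
    have "- (\<kappa> * p' / 4) \<le> \<kappa> / 4 * max (- p') 0"
      using \<open>0 < \<kappa>\<close> by (simp add: max_def mult_le_0_iff)
    then show "- (\<kappa> * p' / 4) \<le> \<kappa> / 4"
      using p' \<kappa>p by simp
  qed simp
  \<comment> \<open>The Tikhonov term pulls towards 0 instead of \<open>xs\<close>; this is the
    origin of the forcing \<open>xs \<bullet> u\<close>.\<close>
  moreover have "\<kappa> * (u \<bullet> y) = \<kappa> * (norm u)\<^sup>2 + \<kappa> * (xs \<bullet> u)"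
    by (simp add: u_def power2_norm_eq_inner inner_diff_left inner_diff_right inner_commute algebra_simps)
  moreover have "p * a * gap y \<le> (\<kappa> - \<eta>1) * a * gap y"
    using \<kappa>p a gap_nonneg[of y] by (intro mult_right_mono) auto
  moreover have "\<eta>2 * (norm v)\<^sup>2 \<le> (\<delta> - \<kappa> - p / 2 - \<kappa> * L / 2 * \<beta>\<^sup>2) * (norm v)\<^sup>2"
    using d by (intro mult_right_mono) auto
  moreover have "a * ((gz - gy) \<bullet> v) \<ge> 0"
    using calculation(2) a by simp
  ultimately show ?thesis
    unfolding r_def[symmetric] by (simp add: algebra_simps)
qed

text \<open>The left-hand side is the derivative in the new time of
  \<open>e\<^sup>2 * ((A *v v) \<bullet> \<mu>)\<close>. The weight cancels the factor
  \<open>1 / e\<^sup>2\<close> in \<open>accel\<close>, so that the multiplier force yields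
  \<open>- (norm (transpose A *v \<mu>))\<^sup>2\<close>; Cauchy-Schwarz and Young bound the rest,
  uniformly in \<open>e\<close>, \<open>p\<close> and \<open>\<theta>\<close>.\<close>

lemma cross_term_dissipation:
  assumes "0 \<le> \<kappa>" "0 \<le> \<rho>" "0 \<le> g" "0 \<le> \<delta>"
  shows "\<exists>C\<ge>0. \<forall>e p \<theta> y v \<mu>. 0 < e \<and> e \<le> 1 \<and> 0 \<le> p \<and> p \<le> \<kappa> \<and> 0 \<le> \<theta> \<and> \<theta> \<le> 1 \<longrightarrow>
    e\<^sup>2 * ((A *v accel \<delta> \<rho> e p \<theta> y v \<mu>) \<bullet> \<mu>) + g * ((A *v v) \<bullet> (A *v (\<kappa> *\<^sub>R (y - xs) + v)))
      - e\<^sup>2 * p * ((A *v v) \<bullet> \<mu>)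
    \<le> - (norm (transpose A *v \<mu>))\<^sup>2 / 2 + C * ((norm (y - xs))\<^sup>2 + (norm v)\<^sup>2) + e ^ 4 * (norm xs)\<^sup>2"
proof -
  obtain K1 where K1: "K1 > 0" "\<And>x. norm (A *v x) \<le> norm x * K1"
    using bounded_linear.pos_bounded[OF matrix_vector_mul_bounded_linear[of A]] by blast
  obtain K2 where K2: "K2 > 0" "\<And>x. norm (transpose A *v x) \<le> norm x * K2"
    using bounded_linear.pos_bounded[OF matrix_vector_mul_bounded_linear[of "transpose A"]] by blast
  \<comment> \<open>The summands come from the gradient, the penalty, the damping together with the
    derivative of the weight (\<open>\<delta> + \<kappa>\<close>), and the Tikhonov term.\<close>
  define C1 where "C1 = L + \<rho> * K1 * K2 + \<delta> + \<kappa> + 1"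
  define C2 where "C2 = g * K1\<^sup>2 * (\<kappa> + 1)"
  have C: "C1 \<ge> 0" "C2 \<ge> 0"
    using assms K1 K2 L_nonneg by (auto simp: C1_def C2_def)
  show ?thesis
  proof (intro exI[of _ "2 * C1\<^sup>2 + 2 * C2"] conjI allI impI)
    show "2 * C1\<^sup>2 + 2 * C2 \<ge> 0" using C by simp
  next
    fix e p \<theta> :: real and y v :: "real ^ 'n" and \<mu> :: "real ^ 'm"
    assume prems: "0 < e \<and> e \<le> 1 \<and> 0 \<le> p \<and> p \<le> \<kappa> \<and> 0 \<le> \<theta> \<and> \<theta> \<le> 1"
    have e2: "0 < e\<^sup>2" "e\<^sup>2 \<le> 1" using prems by (auto simp: power_le_one)
    define q where "q = transpose A *v \<mu>"
    define u where "u = y - xs"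
    define N where "N = norm u + norm v"
    define gz where "gz = grad (y + \<theta> *\<^sub>R v) - grad xs"
    define h where "h = A *v u + \<theta> *\<^sub>R (A *v v)"
    have N: "N \<ge> 0" "norm u \<le> N" "norm v \<le> N" by (auto simp: N_def)
    have \<theta>v: "norm (\<theta> *\<^sub>R z) \<le> norm z" for z :: "'a :: real_normed_vector"
      using prems by (simp add: mult_left_le_one_le)
    have "norm (u + \<theta> *\<^sub>R v) \<le> N"
      unfolding N_def using norm_triangle_ineq[of u "\<theta> *\<^sub>R v"] \<theta>v[of v] by linarith
    then have gz: "norm gz \<le> L * N"
      using norm_grad_diff_le[of "y + \<theta> *\<^sub>R v" xs] L_nonneg
      by (simp add: gz_def u_def algebra_simps) (smt (verit) mult_left_mono)
    have "norm h \<le> norm (A *v u) + norm (A *v v)"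
      unfolding h_def using norm_triangle_ineq[of "A *v u"] \<theta>v[of "A *v v"] by (smt (verit))
    also have "\<dots> \<le> N * K1"
      using K1(2)[of u] K1(2)[of v] by (simp add: N_def algebra_simps)
    finally have h: "norm (transpose A *v h) \<le> K1 * K2 * N"
      using K2(1) K2(2)[of h] by (smt (verit) mult.commute mult.left_commute mult_right_mono)
    have step: "- (s \<bullet> q) \<le> B * norm q" if "norm s \<le> B" for s B
      using that norm_cauchy_schwarz[of "- s" q]
      by (smt (verit) inner_minus_left mult_right_mono norm_ge_zero norm_minus_cancel)
    have "e\<^sup>2 * ((A *v accel \<delta> \<rho> e p \<theta> y v \<mu>) \<bullet> \<mu>) = e\<^sup>2 * (accel \<delta> \<rho> e p \<theta> y v \<mu> \<bullet> q)"
      by (simp del: transpose_matrix_vector add: q_def inner_transpose)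
    also have "e\<^sup>2 * (accel \<delta> \<rho> e p \<theta> y v \<mu> \<bullet> q) = - (e\<^sup>2 * (\<delta> - p / 2)) * (v \<bullet> q)
        - (gz \<bullet> q + q \<bullet> q + \<rho> * ((transpose A *v h) \<bullet> q)) - e\<^sup>2 * ((u + xs) \<bullet> q)"
      unfolding accel_def u_def[symmetric] h_def[symmetric] gz_def[symmetric] q_def[symmetric]
      using e2(1)
      by (simp del: transpose_matrix_vector add: inner_diff_left inner_add_left algebra_simps u_def)
    finally have "e\<^sup>2 * ((A *v accel \<delta> \<rho> e p \<theta> y v \<mu>) \<bullet> \<mu>) - e\<^sup>2 * p * ((A *v v) \<bullet> \<mu>) =
        - (norm q)\<^sup>2 - gz \<bullet> q - (\<rho> *\<^sub>R (transpose A *v h)) \<bullet> q - ((e\<^sup>2 * (\<delta> + p / 2)) *\<^sub>R v) \<bullet> q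
        - (e\<^sup>2 *\<^sub>R u) \<bullet> q - (e\<^sup>2 *\<^sub>R xs) \<bullet> q"
      by (simp del: transpose_matrix_vector
          add: q_def inner_transpose[symmetric] power2_norm_eq_inner inner_add_left algebra_simps)
    also have "\<dots> \<le> - (norm q)\<^sup>2 + L * N * norm q + (\<rho> * (K1 * K2 * N)) * norm q
        + ((\<delta> + \<kappa>) * N) * norm q + N * norm q + (e\<^sup>2 * norm xs) * norm q"
    proof -
      have "norm (\<rho> *\<^sub>R (transpose A *v h)) \<le> \<rho> * (K1 * K2 * N)"
        using h assms by (simp add: mult_left_mono)
      moreover have "norm ((e\<^sup>2 * (\<delta> + p / 2)) *\<^sub>R v) \<le> (\<delta> + \<kappa>) * N"
      proof -
        have "e\<^sup>2 * (\<delta> + p / 2) \<le> 1 * (\<delta> + \<kappa>)"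
          using e2 prems assms by (intro mult_mono) auto
        then show ?thesis
          using N e2 prems assms by (simp add: abs_mult) (smt (verit) mult_mono norm_ge_zero)
      qed
      moreover have "norm (e\<^sup>2 *\<^sub>R u) \<le> N"
        using N e2 by (simp add: mult_left_le_one_le order_trans[OF mult_left_le_one_le])
      moreover have "norm (e\<^sup>2 *\<^sub>R xs) \<le> e\<^sup>2 * norm xs"
        by simp
      ultimately show ?thesis
        using step[OF gz] step[of "\<rho> *\<^sub>R (transpose A *v h)"]
          step[of "(e\<^sup>2 * (\<delta> + p / 2)) *\<^sub>R v"] step[of "e\<^sup>2 *\<^sub>R u"] step[of "e\<^sup>2 *\<^sub>R xs"]
        by (smt (verit))
    qed
    also have "\<dots> = - (norm q)\<^sup>2 + C1 * N * norm q + e\<^sup>2 * norm xs * norm q"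
      by (simp add: C1_def algebra_simps)
    also have "\<dots> \<le> - (norm q)\<^sup>2 / 2 + C1\<^sup>2 * N\<^sup>2 + e ^ 4 * (norm xs)\<^sup>2"
    proof -
      \<comment> \<open>Young's inequality with a quarter on one side: used twice, it leaves half of
        \<open>(norm q)\<^sup>2\<close>.\<close>
      have ab: "s * n \<le> s\<^sup>2 + n\<^sup>2 / 4" for s n :: real
        using zero_le_power2[of "s - n / 2"] by (simp add: power2_eq_square algebra_simps)
      show ?thesis
        using ab[of "C1 * N" "norm q"] ab[of "e\<^sup>2 * norm xs" "norm q"]
        by (simp add: power_mult_distrib flip: power_mult)
    qed
    finally have main: "e\<^sup>2 * ((A *v accel \<delta> \<rho> e p \<theta> y v \<mu>) \<bullet> \<mu>) - e\<^sup>2 * p * ((A *v v) \<bullet> \<mu>)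
        \<le> - (norm q)\<^sup>2 / 2 + C1\<^sup>2 * N\<^sup>2 + e ^ 4 * (norm xs)\<^sup>2" .
    have "g * ((A *v v) \<bullet> (A *v (\<kappa> *\<^sub>R u + v))) \<le> C2 * N\<^sup>2"
    proof -
      have "norm (\<kappa> *\<^sub>R u + v) \<le> \<kappa> * norm u + norm v"
        using norm_triangle_ineq[of "\<kappa> *\<^sub>R u" v] assms by simp
      also have "\<dots> \<le> (\<kappa> + 1) * N"
        using N(3) mult_left_mono[OF N(2), of \<kappa>] assms by (simp add: algebra_simps)
      finally have "norm (A *v (\<kappa> *\<^sub>R u + v)) \<le> ((\<kappa> + 1) * N) * K1"
        using K1 by (meson mult_right_mono less_imp_le order_trans)
      moreover have "norm (A *v v) \<le> N * K1"
        using K1 N by (meson mult_right_mono less_imp_le order_trans)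
      ultimately have "(A *v v) \<bullet> (A *v (\<kappa> *\<^sub>R u + v)) \<le> (N * K1) * ((\<kappa> + 1) * N * K1)"
        using norm_cauchy_schwarz[of "A *v v" "A *v (\<kappa> *\<^sub>R u + v)"] N K1
        by (meson mult_mono mult_nonneg_nonneg less_imp_le norm_ge_zero order_trans)
      then have "g * ((A *v v) \<bullet> (A *v (\<kappa> *\<^sub>R u + v))) \<le> g * ((N * K1) * ((\<kappa> + 1) * N * K1))"
        using assms by (intro mult_left_mono) auto
      then show ?thesis
        by (simp add: C2_def power2_eq_square algebra_simps)
    qed
    \<comment> \<open>Passing from \<open>N\<^sup>2\<close> to the sum of squares explains the
      factor 2 in the witness.\<close>
    moreover have "(C1\<^sup>2 + C2) * N\<^sup>2 \<le> (C1\<^sup>2 + C2) * (2 * ((norm u)\<^sup>2 + (norm v)\<^sup>2))"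
      using C zero_le_power2[of "norm u - norm v"]
      by (intro mult_left_mono) (auto simp: N_def power2_eq_square algebra_simps)
    ultimately show "e\<^sup>2 * ((A *v accel \<delta> \<rho> e p \<theta> y v \<mu>) \<bullet> \<mu>)
        + g * ((A *v v) \<bullet> (A *v (\<kappa> *\<^sub>R (y - xs) + v))) - e\<^sup>2 * p * ((A *v v) \<bullet> \<mu>)
      \<le> - (norm (transpose A *v \<mu>))\<^sup>2 / 2 + (2 * C1\<^sup>2 + 2 * C2) * ((norm (y - xs))\<^sup>2 + (norm v)\<^sup>2)
        + e ^ 4 * (norm xs)\<^sup>2"
      using main unfolding q_def[symmetric] u_def[symmetric] by (simp add: algebra_simps)
  qed
qed

end

section \<open>Trajectories in the new time and the derivative of the energy\<close>

lemma has_real_derivative_inner: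
  fixes f g :: "real \<Rightarrow> 'a::real_inner"
  assumes "(f has_vector_derivative f') (at t within S)" "(g has_vector_derivative g') (at t within S)"
  shows "((\<lambda>t. f t \<bullet> g t) has_real_derivative f t \<bullet> g' + f' \<bullet> g t) (at t within S)"
  using bounded_bilinear.has_vector_derivative[OF bounded_bilinear_inner assms]
  by (simp add: has_real_derivative_iff_has_vector_derivative)

lemma has_vector_derivative_matrix_vector_mult:
  fixes A :: "real ^ 'n ^ 'm"
  assumes "(f has_vector_derivative f') F"
  shows "((\<lambda>t. A *v f t) has_vector_derivative A *v f') F"
  using bounded_linear.has_vector_derivative[OF matrix_vector_mul_bounded_linear assms] .

lemma tendsto_zero_of_norm_square:
  fixes h :: "real \<Rightarrow> 'b::real_normed_vector"
  assumes "((\<lambda>t. (norm (h t))\<^sup>2) \<longlongrightarrow> 0) F"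
  shows "(h \<longlongrightarrow> 0) F"
  using tendsto_real_sqrt[OF assms] by (simp add: tendsto_norm_zero_iff)

text \<open>The system in the variables of the new time \<open>E\<close>, but still parametrised by the original time:
  \<open>e\<close> is the square root of \<open>\<epsilon>\<close>, \<open>v = x' / e\<close>, \<open>\<kappa> = \<sigma> / \<gamma>\<close> and \<open>g = \<gamma>\<^sup>2 / \<sigma>\<close>; \<open>p'\<close> is the
  derivative of \<open>p\<close> in the new time, hence the factor \<open>e\<close> in its derivative.\<close>

locale primal_dual_trajectory = linearly_constrained_problem f grad A b L xs ld
  for f :: "real ^ 'n \<Rightarrow> real" and grad and A :: "real ^ 'n ^ 'm" and b L xs ld +
  fixes T \<delta> \<rho> \<kappa> g \<eta>1 \<eta>2 :: real and e E p p' \<beta> :: "real \<Rightarrow> real"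
    and x v :: "real \<Rightarrow> real ^ 'n" and lam :: "real \<Rightarrow> real ^ 'm"
  assumes pos: "0 < \<kappa>" "0 < \<rho>" "0 < g" "0 < \<delta>" "0 < \<eta>1" "0 < \<eta>2"
    and e_pos: "t \<ge> T \<Longrightarrow> e t > 0"
    and e_deriv: "t \<ge> T \<Longrightarrow> (e has_real_derivative - p t * (e t)\<^sup>2 / 2) (at t)"
    and e_lim: "(e \<longlongrightarrow> 0) at_top"
    and E_deriv: "t \<ge> T \<Longrightarrow> (E has_real_derivative e t) (at t)"
    and p_nonneg: "t \<ge> T \<Longrightarrow> p t \<ge> 0"
    and p_le: "t \<ge> T \<Longrightarrow> \<kappa> - p t \<ge> \<eta>1"
    and damping: "t \<ge> T \<Longrightarrow> \<delta> - \<kappa> - p t / 2 - \<kappa> * L / 2 * (\<beta> t)\<^sup>2 \<ge> \<eta>2"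
    and p_deriv: "t \<ge> T \<Longrightarrow> (p has_real_derivative e t * p' t) (at t)"
    and p'_le: "t \<ge> T \<Longrightarrow> \<kappa> / 4 * max (- p' t) 0 \<le> (\<kappa> + p t) / 8"
    and \<beta>_nonneg: "t \<ge> T \<Longrightarrow> \<beta> t \<ge> 0"
    and \<beta>_bdd: "\<exists>B. \<forall>t\<ge>T. \<beta> t \<le> B"
    and x_deriv: "t \<ge> T \<Longrightarrow> (x has_vector_derivative e t *\<^sub>R v t) (at t)"
    and v_deriv: "t \<ge> T \<Longrightarrow> (v has_vector_derivative
      e t *\<^sub>R accel \<delta> \<rho> (e t) (p t) (\<beta> t * e t) (x t) (v t) (lam t - ld)) (at t)"
    and lam_deriv: "t \<ge> T \<Longrightarrow>
      (lam has_vector_derivative (g / e t) *\<^sub>R (A *v (\<kappa> *\<^sub>R (x t - xs) + v t))) (at t)"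
    and lam_range: "t \<ge> T \<Longrightarrow> lam t - ld \<in> range ((*v) A)"
begin

definition a where "a t = 1 / (e t)\<^sup>2"
definition u where "u t = x t - xs"
text \<open>The combination whose image under \<open>A\<close> drives the multiplier.\<close>

definition w where "w t = \<kappa> *\<^sub>R u t + v t"
definition \<mu> where "\<mu> t = lam t - ld"
definition acc where "acc t = accel \<delta> \<rho> (e t) (p t) (\<beta> t * e t) (x t) (v t) (\<mu> t)"

lemma a_pos: "t \<ge> T \<Longrightarrow> a t > 0"
  using e_pos[of t] by (simp add: a_def)

lemma a_e: "t \<ge> T \<Longrightarrow> a t * (e t)\<^sup>2 = 1"
  using e_pos[of t] by (simp add: a_def)

lemma a_lim: "filterlim a at_top at_top"
proof -
  have "((\<lambda>t. (e t)\<^sup>2) \<longlongrightarrow> 0\<^sup>2) at_top"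
    by (intro tendsto_intros e_lim)
  moreover have "\<forall>\<^sub>F t in at_top. (e t)\<^sup>2 > 0"
    using eventually_ge_at_top[of T] by eventually_elim (use e_pos in fastforce)
  ultimately have "filterlim (\<lambda>t. inverse ((e t)\<^sup>2)) at_top at_top"
    by (intro filterlim_inverse_at_top) auto
  then show ?thesis
    by (simp add: a_def[abs_def] inverse_eq_divide)
qed

text \<open>No finite end of the new time is possible: \<open>1 / e\<close> tends to infinity, but grows at most
  exponentially in the new time because \<open>p\<close> is bounded.\<close>

lemma E_lim: "filterlim E at_top at_top"
proof -
  \<comment> \<open>In the new time \<open>- ln e\<close> has derivative \<open>p / 2\<close>, which
    stays below \<open>\<kappa> / 2\<close>.\<close>
  have mono: "- ln (e t) - \<kappa> / 2 * E t \<le> - ln (e T) - \<kappa> / 2 * E T" if "t \<ge> T" for t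
  proof (rule DERIV_nonpos_imp_nonincreasing[where f = "\<lambda>t. - ln (e t) - \<kappa> / 2 * E t", OF that])
    fix s assume s: "T \<le> s" "s \<le> t"
    have "((\<lambda>t. - ln (e t) - \<kappa> / 2 * E t) has_real_derivative (p s - \<kappa>) / 2 * e s) (at s)"
      using e_pos[OF s(1)]
      by (auto intro!: derivative_eq_intros e_deriv E_deriv s(1) simp: power2_eq_square field_simps)
    moreover have "(p s - \<kappa>) / 2 * e s \<le> 0"
      using e_pos[OF s(1)] p_le[OF s(1)] pos by (intro mult_nonpos_nonneg) auto
    ultimately show "\<exists>y. ((\<lambda>t. - ln (e t) - \<kappa> / 2 * E t) has_real_derivative y) (at s) \<and> y \<le> 0"
      by blast
  qed
  have "filterlim (\<lambda>t. ln (e t)) at_bot at_top"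
  proof (rule filterlim_compose[OF ln_at_0])
    show "filterlim e (at_right 0) at_top"
      unfolding filterlim_at
      using e_lim by (auto intro!: eventually_mono[OF eventually_ge_at_top[of T]] dest: e_pos)
  qed
  then have "filterlim (\<lambda>t. - ln (e t)) at_top at_top"
    by (simp add: filterlim_uminus_at_top)
  then have "filterlim (\<lambda>t. 2 / \<kappa> * (ln (e T) + \<kappa> / 2 * E T + - ln (e t))) at_top at_top"
    using pos
    by (intro filterlim_tendsto_pos_mult_at_top[OF tendsto_const] filterlim_tendsto_add_at_top[OF tendsto_const]) auto
  moreover have "\<forall>\<^sub>F t in at_top. 2 / \<kappa> * (ln (e T) + \<kappa> / 2 * E T + - ln (e t)) \<le> E t"
    using eventually_ge_at_top[of T]
  proof eventually_elim
    case (elim t)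
    then show ?case
      using mono[OF elim] pos by (simp add: field_simps)
  qed
  ultimately show ?thesis
    by (rule filterlim_at_top_mono)
qed

lemma eventually_penalty_lower_bound:
  assumes "c1 > 0" "c2 > 0" "q > 0" "\<tau> > 0" "C \<ge> 0"
  shows "\<forall>\<^sub>F t in at_top.
    - \<tau> \<le> a t * (c1 * gap (x t) + c2 * (norm (A *v u t))\<^sup>2) + q * (norm (u t))\<^sup>2 + C * (xs \<bullet> u t)"
proof -
  obtain a0 where a0: "\<And>a y. a \<ge> a0 \<Longrightarrow>
      - \<tau> \<le> a * (c1 * gap y + c2 * (norm (A *v y - b))\<^sup>2) + q * (norm (y - xs))\<^sup>2 + C * (xs \<bullet> (y - xs))"
    using penalty_lower_bound[OF assms] by blast
  have "\<forall>\<^sub>F t in at_top. a0 \<le> a t"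
    using a_lim by (simp add: filterlim_at_top)
  then show ?thesis
    by eventually_elim (use a0 in \<open>simp add: u_def matrix_vector_mult_diff_distrib feasible\<close>)
qed

text \<open>The weights are chosen for cancellation: \<open>1 / (2 * g)\<close> against the
  multiplier force acting on \<open>w\<close>, the norm difference against
  \<open>x \<bullet> v\<close>, the coefficient of \<open>(norm (u t))\<^sup>2\<close> against
  \<open>u \<bullet> v\<close>. The norm difference and the cross term have no sign, so
  nonnegativity holds only up to vanishing terms.\<close>

definition energy where
  "energy \<xi> t = (norm (w t))\<^sup>2 / 2 + (norm (\<mu> t))\<^sup>2 / (2 * g) + a t * gap (x t)
     + \<rho> / 2 * (a t * (norm (A *v u t))\<^sup>2) + ((norm (x t))\<^sup>2 - (norm xs)\<^sup>2) / 2
     + \<kappa> / 2 * ((\<delta> - \<kappa> - p t / 2) * (norm (u t))\<^sup>2) + \<xi> * ((e t)\<^sup>2 * ((A *v v t) \<bullet> \<mu> t))"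

lemma a_deriv: "t \<ge> T \<Longrightarrow> (a has_real_derivative e t * (p t * a t)) (at t)"
  unfolding a_def using e_pos[of t]
  by (auto intro!: derivative_eq_intros e_deriv simp: power2_eq_square field_simps)

lemma e2_deriv: "t \<ge> T \<Longrightarrow> ((\<lambda>t. (e t)\<^sup>2) has_real_derivative - (e t * ((e t)\<^sup>2 * p t))) (at t)"
  by (auto intro!: derivative_eq_intros e_deriv simp: power2_eq_square field_simps)

lemma u_deriv: "t \<ge> T \<Longrightarrow> (u has_vector_derivative e t *\<^sub>R v t) (at t)"
  unfolding u_def by (auto intro!: derivative_eq_intros x_deriv)

lemma Au_deriv: "t \<ge> T \<Longrightarrow> ((\<lambda>t. A *v u t) has_vector_derivative e t *\<^sub>R (A *v v t)) (at t)"
  using has_vector_derivative_matrix_vector_mult[OF u_deriv, of t A]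
  by (simp add: matrix_vector_mult_scaleR)

lemma v_deriv': "t \<ge> T \<Longrightarrow> (v has_vector_derivative e t *\<^sub>R acc t) (at t)"
  using v_deriv[of t] by (simp add: acc_def \<mu>_def)

lemma w_deriv: "t \<ge> T \<Longrightarrow> (w has_vector_derivative e t *\<^sub>R (\<kappa> *\<^sub>R v t + acc t)) (at t)"
  unfolding w_def by (auto intro!: derivative_eq_intros u_deriv v_deriv' simp: algebra_simps)

lemma \<mu>_deriv: "t \<ge> T \<Longrightarrow> (\<mu> has_vector_derivative e t *\<^sub>R ((g * a t) *\<^sub>R (A *v w t))) (at t)"
  using lam_deriv[of t] e_pos[of t] unfolding \<mu>_def w_def u_def a_def
  by (auto intro!: derivative_eq_intros simp: power2_eq_square)

lemma gap_deriv:
  assumes "t \<ge> T"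
  shows "((\<lambda>t. gap (x t)) has_real_derivative e t * ((grad (x t) - grad xs) \<bullet> v t)) (at t)"
proof -
  have "(gap has_derivative (\<lambda>h. h \<bullet> (grad (x t) - grad xs))) (at (x t))"
    using GDERIV_gap by (simp add: gderiv_def)
  from has_derivative_compose[OF x_deriv[OF assms, unfolded has_vector_derivative_def] this]
  show ?thesis
    by (simp add: has_field_derivative_def inner_commute mult_ac mult_commute_abs)
qed

text \<open>The bracket is arranged for the two estimates to come: the part with
  \<open>\<xi>\<close> is what \<open>cross_term_dissipation\<close> bounds, the rest is what
  \<open>energy_dissipation\<close> bounds.\<close>

lemma energy_deriv:
  assumes t: "t \<ge> T"
  shows "(energy \<xi> has_real_derivative e t * (
      (\<kappa> *\<^sub>R u t + v t) \<bullet> (\<kappa> *\<^sub>R v t + acc t)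
      + a t * (\<mu> t \<bullet> (A *v (\<kappa> *\<^sub>R u t + v t)))
      + a t * (p t * gap (x t) + (grad (x t) - grad xs) \<bullet> v t)
      + \<rho> * a t * (p t / 2 * (norm (A *v u t))\<^sup>2 + (A *v u t) \<bullet> (A *v v t))
      + x t \<bullet> v t
      + \<kappa> * ((\<delta> - \<kappa> - p t / 2) * (u t \<bullet> v t) - p' t / 4 * (norm (u t))\<^sup>2)
      + \<xi> * ((e t)\<^sup>2 * ((A *v acc t) \<bullet> \<mu> t) + g * ((A *v v t) \<bullet> (A *v (\<kappa> *\<^sub>R u t + v t)))
          - (e t)\<^sup>2 * p t * ((A *v v t) \<bullet> \<mu> t)))) (at t)"
proof -
  have d1: "((\<lambda>t. (norm (w t))\<^sup>2) has_real_derivative e t * (2 * (w t \<bullet> (\<kappa> *\<^sub>R v t + acc t)))) (at t)"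
    unfolding power2_norm_eq_inner
    by (rule DERIV_cong[OF has_real_derivative_inner[OF w_deriv[OF t] w_deriv[OF t]]])
       (simp add: inner_commute)
  have d2: "((\<lambda>t. (norm (\<mu> t))\<^sup>2) has_real_derivative e t * (2 * g * a t * (\<mu> t \<bullet> (A *v w t)))) (at t)"
    unfolding power2_norm_eq_inner
    by (rule DERIV_cong[OF has_real_derivative_inner[OF \<mu>_deriv[OF t] \<mu>_deriv[OF t]]])
       (simp add: inner_commute)
  have d3: "((\<lambda>t. (norm (A *v u t))\<^sup>2) has_real_derivative e t * (2 * ((A *v u t) \<bullet> (A *v v t)))) (at t)"
    unfolding power2_norm_eq_inner
    by (rule DERIV_cong[OF has_real_derivative_inner[OF Au_deriv[OF t] Au_deriv[OF t]]])
       (simp add: inner_commute)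
  have d4: "((\<lambda>t. (norm (x t))\<^sup>2) has_real_derivative e t * (2 * (x t \<bullet> v t))) (at t)"
    unfolding power2_norm_eq_inner
    by (rule DERIV_cong[OF has_real_derivative_inner[OF x_deriv[OF t] x_deriv[OF t]]])
       (simp add: inner_commute)
  have d5: "((\<lambda>t. (norm (u t))\<^sup>2) has_real_derivative e t * (2 * (u t \<bullet> v t))) (at t)"
    unfolding power2_norm_eq_inner
    by (rule DERIV_cong[OF has_real_derivative_inner[OF u_deriv[OF t] u_deriv[OF t]]])
       (simp add: inner_commute)
  have d6: "((\<lambda>t. (A *v v t) \<bullet> \<mu> t) has_real_derivative
      e t * (g * a t * ((A *v v t) \<bullet> (A *v w t)) + (A *v acc t) \<bullet> \<mu> t)) (at t)"
    by (rule DERIV_cong[OF has_real_derivative_inner[OF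
          has_vector_derivative_matrix_vector_mult[OF v_deriv'[OF t]] \<mu>_deriv[OF t]]])
       (simp add: matrix_vector_mult_scaleR algebra_simps)
  have "(energy \<xi> has_real_derivative
      e t * (2 * (w t \<bullet> (\<kappa> *\<^sub>R v t + acc t))) / 2
      + e t * (2 * g * a t * (\<mu> t \<bullet> (A *v w t))) / (2 * g)
      + (e t * (p t * a t) * gap (x t) + e t * ((grad (x t) - grad xs) \<bullet> v t) * a t)
      + \<rho> / 2 * (e t * (p t * a t) * (norm (A *v u t))\<^sup>2 + e t * (2 * ((A *v u t) \<bullet> (A *v v t))) * a t)
      + (e t * (2 * (x t \<bullet> v t)) - 0) / 2
      + \<kappa> / 2 * ((0 - e t * p' t / 2) * (norm (u t))\<^sup>2 + e t * (2 * (u t \<bullet> v t)) * (\<delta> - \<kappa> - p t / 2))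
      + \<xi> * (- (e t * ((e t)\<^sup>2 * p t)) * ((A *v v t) \<bullet> \<mu> t)
          + e t * (g * a t * ((A *v v t) \<bullet> (A *v w t)) + (A *v acc t) \<bullet> \<mu> t) * (e t)\<^sup>2)) (at t)"
    unfolding energy_def
    by (intro DERIV_add DERIV_diff DERIV_cdivide DERIV_cmult DERIV_mult DERIV_const
        d1 d2 d3 d4 d5 d6 a_deriv[OF t] e2_deriv[OF t] gap_deriv[OF t] p_deriv[OF t])
  then show ?thesis
  proof (rule DERIV_cong)
    show "e t * (2 * (w t \<bullet> (\<kappa> *\<^sub>R v t + acc t))) / 2
      + e t * (2 * g * a t * (\<mu> t \<bullet> (A *v w t))) / (2 * g)
      + (e t * (p t * a t) * gap (x t) + e t * ((grad (x t) - grad xs) \<bullet> v t) * a t)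
      + \<rho> / 2 * (e t * (p t * a t) * (norm (A *v u t))\<^sup>2 + e t * (2 * ((A *v u t) \<bullet> (A *v v t))) * a t)
      + (e t * (2 * (x t \<bullet> v t)) - 0) / 2
      + \<kappa> / 2 * ((0 - e t * p' t / 2) * (norm (u t))\<^sup>2 + e t * (2 * (u t \<bullet> v t)) * (\<delta> - \<kappa> - p t / 2))
      + \<xi> * (- (e t * ((e t)\<^sup>2 * p t)) * ((A *v v t) \<bullet> \<mu> t)
          + e t * (g * a t * ((A *v v t) \<bullet> (A *v w t)) + (A *v acc t) \<bullet> \<mu> t) * (e t)\<^sup>2) =
      e t * (
      (\<kappa> *\<^sub>R u t + v t) \<bullet> (\<kappa> *\<^sub>R v t + acc t)
      + a t * (\<mu> t \<bullet> (A *v (\<kappa> *\<^sub>R u t + v t)))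
      + a t * (p t * gap (x t) + (grad (x t) - grad xs) \<bullet> v t)
      + \<rho> * a t * (p t / 2 * (norm (A *v u t))\<^sup>2 + (A *v u t) \<bullet> (A *v v t))
      + x t \<bullet> v t
      + \<kappa> * ((\<delta> - \<kappa> - p t / 2) * (u t \<bullet> v t) - p' t / 4 * (norm (u t))\<^sup>2)
      + \<xi> * ((e t)\<^sup>2 * ((A *v acc t) \<bullet> \<mu> t) + g * ((A *v v t) \<bullet> (A *v (\<kappa> *\<^sub>R u t + v t)))
          - (e t)\<^sup>2 * p t * ((A *v v t) \<bullet> \<mu> t)))"
      using pos(3) a_e[OF t] unfolding w_def[symmetric]
      by (simp add: distrib_left distrib_right right_diff_distrib left_diff_distrib mult_ac)
  qed
qed

end

section \<open>Convergence of trajectories\<close>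

context primal_dual_trajectory
begin

text \<open>Supplies the smallness of \<open>\<theta>\<close> that both dissipation estimates
  require.\<close>

lemma theta_lim: "((\<lambda>t. \<beta> t * e t) \<longlongrightarrow> 0) at_top"
proof -
  obtain B where B: "\<And>t. t \<ge> T \<Longrightarrow> \<beta> t \<le> B"
    using \<beta>_bdd by blast
  have "((\<lambda>t. B * e t) \<longlongrightarrow> B * 0) at_top"
    by (intro tendsto_intros e_lim)
  then have lim: "((\<lambda>t. B * e t) \<longlongrightarrow> 0) at_top" by simp
  have "0 \<le> \<beta> t * e t" "\<beta> t * e t \<le> B * e t" if "t \<ge> T" for t
    using B[OF that] \<beta>_nonneg[OF that] e_pos[OF that] by (simp_all add: mult_right_mono)
  then show ?thesis
    by (intro tendsto_sandwich[OF _ _ tendsto_const lim]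
        eventually_mono[OF eventually_ge_at_top[of T]]) auto
qed

lemma half_norm_square_diff: "((norm (x t))\<^sup>2 - (norm xs)\<^sup>2) / 2 = (norm (u t))\<^sup>2 / 2 + xs \<bullet> u t"
proof -
  have "(norm (x t))\<^sup>2 = (norm (u t))\<^sup>2 + 2 * (xs \<bullet> u t) + (norm xs)\<^sup>2"
    by (simp add: u_def power2_norm_eq_inner inner_diff_left inner_diff_right inner_commute)
  then show ?thesis by simp
qed

text \<open>All is bounded by quantities that dissipate, except \<open>xs \<bullet> u t\<close>,
  kept with coefficient 1 in order to be merged with the forcing.\<close>

lemma energy_le:
  assumes "t \<ge> T" "e t \<le> 1" "\<xi> \<ge> 0" and K: "K > 0" "\<And>y. norm (A *v y) \<le> norm y * K"
  shows "energy \<xi> t \<le> a t * gap (x t) + \<rho> / 2 * (a t * (norm (A *v u t))\<^sup>2) + xs \<bullet> u t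
     + (\<kappa>\<^sup>2 + 2 + 1 / (2 * g) + \<kappa> * \<delta> / 2 + \<xi> * K) * ((norm (u t))\<^sup>2 + (norm (v t))\<^sup>2 + (norm (\<mu> t))\<^sup>2)"
proof -
  define U where "U = (norm (u t))\<^sup>2"
  define N where "N = (norm (v t))\<^sup>2"
  define M where "M = (norm (\<mu> t))\<^sup>2"
  have nn: "U \<ge> 0" "N \<ge> 0" "M \<ge> 0" by (auto simp: U_def N_def M_def)
  have "(norm (w t))\<^sup>2 / 2 \<le> \<kappa>\<^sup>2 * U + N"
  proof -
    have "(norm (w t))\<^sup>2 \<le> (\<kappa> * norm (u t) + norm (v t))\<^sup>2"
      using norm_triangle_ineq[of "\<kappa> *\<^sub>R u t" "v t"] pos by (intro power_mono) (auto simp: w_def)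
    moreover have "0 \<le> (\<kappa> * norm (u t) - norm (v t))\<^sup>2" by simp
    ultimately show ?thesis
      by (simp add: U_def N_def power2_eq_square algebra_simps)
  qed
  moreover have "((norm (x t))\<^sup>2 - (norm xs)\<^sup>2) / 2 = U / 2 + xs \<bullet> u t"
    using half_norm_square_diff by (simp add: U_def)
  moreover have "\<kappa> / 2 * ((\<delta> - \<kappa> - p t / 2) * U) \<le> \<kappa> / 2 * (\<delta> * U)"
    using pos p_nonneg[OF assms(1)] nn by (intro mult_left_mono mult_right_mono) auto
  moreover have "\<xi> * ((e t)\<^sup>2 * ((A *v v t) \<bullet> \<mu> t)) \<le> \<xi> * (K * (N + M))"
  proof (rule mult_left_mono)
    have e2: "(e t)\<^sup>2 \<le> 1" using e_pos[OF assms(1)] assms(2) by (simp add: power_le_one)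
    have "\<bar>(A *v v t) \<bullet> \<mu> t\<bar> \<le> norm (v t) * K * norm (\<mu> t)"
      using Cauchy_Schwarz_ineq2[of "A *v v t" "\<mu> t"] K(2)[of "v t"]
      by (meson mult_right_mono norm_ge_zero order_trans)
    also have "\<dots> = K * (norm (v t) * norm (\<mu> t))" by simp
    also have "\<dots> \<le> K * (N + M)"
    proof (rule mult_left_mono)
      have "2 * (norm (v t) * norm (\<mu> t)) \<le> N + M"
        using sum_squares_bound[of "norm (v t)" "norm (\<mu> t)"] by (simp add: N_def M_def)
      then show "norm (v t) * norm (\<mu> t) \<le> N + M"
        using nn by linarith
    qed (use K in simp)
    finally have "\<bar>(A *v v t) \<bullet> \<mu> t\<bar> \<le> K * (N + M)" .
    then have "(e t)\<^sup>2 * \<bar>(A *v v t) \<bullet> \<mu> t\<bar> \<le> 1 * (K * (N + M))"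
      using e2 by (intro mult_mono) auto
    moreover have "(e t)\<^sup>2 * ((A *v v t) \<bullet> \<mu> t) \<le> (e t)\<^sup>2 * \<bar>(A *v v t) \<bullet> \<mu> t\<bar>"
      by (intro mult_left_mono) auto
    ultimately show "(e t)\<^sup>2 * ((A *v v t) \<bullet> \<mu> t) \<le> K * (N + M)" by simp
  qed (use assms in simp)
  moreover have "0 \<le> \<kappa>\<^sup>2 * (N + M)" "0 \<le> 1 / (2 * g) * (U + N)"
      "0 \<le> \<kappa> * \<delta> / 2 * (N + M)" "0 \<le> \<xi> * K * U"
    using nn pos assms by auto
  moreover have "(\<kappa>\<^sup>2 + 2 + 1 / (2 * g) + \<kappa> * \<delta> / 2 + \<xi> * K) * (U + N + M)
      = \<kappa>\<^sup>2 * U + \<kappa>\<^sup>2 * (N + M) + 2 * (U + N + M) + (M / (2 * g) + 1 / (2 * g) * (U + N))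
        + (\<kappa> / 2 * (\<delta> * U) + \<kappa> * \<delta> / 2 * (N + M)) + (\<xi> * (K * (N + M)) + \<xi> * K * U)"
    by (simp add: algebra_simps add_divide_distrib)
  ultimately show ?thesis
    using nn unfolding energy_def U_def[symmetric] N_def[symmetric] M_def[symmetric]
    by argo
qed

text \<open>The terms without sign are removed: \<open>xs \<bullet> u t\<close> at the price of half
  the scaled gap, the penalty and \<open>(norm (u t))\<^sup>2 / 2\<close>, the cross term because
  its weight \<open>(e t)\<^sup>2\<close> vanishes.\<close>

lemma energy_ge:
  assumes "\<xi> \<ge> 0" "\<tau> > 0"
  shows "\<forall>\<^sub>F t in at_top. (norm (w t))\<^sup>2 / 4 + (norm (\<mu> t))\<^sup>2 / (4 * g) + a t * gap (x t) / 2
     + \<kappa> * \<eta>2 / 4 * (norm (u t))\<^sup>2 \<le> energy \<xi> t + \<tau>"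
proof -
  obtain K where K: "K > 0" "\<And>y. norm (A *v y) \<le> norm y * K"
    using bounded_linear.pos_bounded[OF matrix_vector_mul_bounded_linear[of A]] by blast
  \<comment> \<open>With this bound the cross term uses at most half of the available weights of
    \<open>w\<close>, \<open>\<mu>\<close> and \<open>u\<close>.\<close>
  define \<omega> where "\<omega> = min (1 / 4) (min (1 / (2 * g)) (\<eta>2 / (4 * \<kappa>)))"
  have \<omega>: "\<omega> > 0" "\<omega> \<le> 1 / 4" "\<omega> / 2 \<le> 1 / (4 * g)" "\<omega> * \<kappa>\<^sup>2 \<le> \<kappa> * \<eta>2 / 4"
  proof -
    show "\<omega> > 0" "\<omega> \<le> 1 / 4" using pos by (auto simp: \<omega>_def)
    have "\<omega> \<le> 1 / (2 * g)" "\<omega> \<le> \<eta>2 / (4 * \<kappa>)" by (auto simp: \<omega>_def)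
    then show "\<omega> / 2 \<le> 1 / (4 * g)" "\<omega> * \<kappa>\<^sup>2 \<le> \<kappa> * \<eta>2 / 4"
      using pos by (auto simp: field_simps power2_eq_square)
  qed
  have "((\<lambda>t. (e t)\<^sup>2 * (\<xi> * K)) \<longlongrightarrow> 0\<^sup>2 * (\<xi> * K)) at_top"
    by (intro tendsto_intros e_lim)
  then have "\<forall>\<^sub>F t in at_top. (e t)\<^sup>2 * (\<xi> * K) < \<omega>"
    using \<omega>(1) by (simp add: order_tendstoD)
  moreover have "\<forall>\<^sub>F t in at_top. - \<tau> \<le> a t * (1 / 2 * gap (x t) + \<rho> / 2 * (norm (A *v u t))\<^sup>2)
      + 1 / 2 * (norm (u t))\<^sup>2 + 1 * (xs \<bullet> u t)"
    by (rule eventually_penalty_lower_bound) (use pos assms in auto)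
  ultimately show ?thesis
    using eventually_ge_at_top[of T]
  proof eventually_elim
    case (elim t)
    define U where "U = (norm (u t))\<^sup>2"
    define W where "W = (norm (w t))\<^sup>2"
    define M where "M = (norm (\<mu> t))\<^sup>2"
    have nn: "U \<ge> 0" "W \<ge> 0" "M \<ge> 0" by (auto simp: U_def W_def M_def)
    have cross: "\<bar>\<xi> * ((e t)\<^sup>2 * ((A *v v t) \<bullet> \<mu> t))\<bar> \<le> \<omega> * (W + \<kappa>\<^sup>2 * U + M / 2)"
    proof -
      \<comment> \<open>The energy controls \<open>w\<close> and \<open>u\<close>, so the velocity
        is recovered as \<open>w t - \<kappa> *\<^sub>R u t\<close>.\<close>
      have "norm (v t) \<le> norm (w t) + \<kappa> * norm (u t)"
        using norm_triangle_ineq4[of "w t" "\<kappa> *\<^sub>R u t"] pos by (simp add: w_def)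
      then have "norm (v t) * norm (\<mu> t) \<le> (norm (w t) + \<kappa> * norm (u t)) * norm (\<mu> t)"
        by (intro mult_right_mono) auto
      also have "\<dots> \<le> W + \<kappa>\<^sup>2 * U + M / 2"
        using zero_le_power2[of "norm (w t) + \<kappa> * norm (u t) - norm (\<mu> t)"]
          zero_le_power2[of "norm (w t) - \<kappa> * norm (u t)"]
        by (simp add: W_def U_def M_def power2_eq_square algebra_simps)
      finally have 1: "norm (v t) * norm (\<mu> t) \<le> W + \<kappa>\<^sup>2 * U + M / 2" .
      have "\<bar>(A *v v t) \<bullet> \<mu> t\<bar> \<le> norm (v t) * K * norm (\<mu> t)"
        using Cauchy_Schwarz_ineq2[of "A *v v t" "\<mu> t"] K(2)[of "v t"]
        by (meson mult_right_mono norm_ge_zero order_trans)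
      then have "\<xi> * (e t)\<^sup>2 * \<bar>(A *v v t) \<bullet> \<mu> t\<bar> \<le> \<xi> * (e t)\<^sup>2 * (norm (v t) * K * norm (\<mu> t))"
        using assms by (intro mult_left_mono) auto
      also have "\<dots> = ((e t)\<^sup>2 * (\<xi> * K)) * (norm (v t) * norm (\<mu> t))"
        by simp
      also have "\<dots> \<le> \<omega> * (W + \<kappa>\<^sup>2 * U + M / 2)"
        using elim(1) 1 \<omega> nn by (intro mult_mono) auto
      finally show ?thesis
        using assms by (simp add: abs_mult mult.assoc)
    qed
    note mult_right_mono[OF \<omega>(2) nn(2)] mult_right_mono[OF \<omega>(4) nn(1)] mult_right_mono[OF \<omega>(3) nn(3)]
    moreover have "\<kappa> / 2 * (\<eta>2 * U) \<le> \<kappa> / 2 * ((\<delta> - \<kappa> - p t / 2) * U)"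
    proof (intro mult_left_mono mult_right_mono)
      show "\<eta>2 \<le> \<delta> - \<kappa> - p t / 2"
        using damping[OF elim(3)] pos L_nonneg
        by (smt (verit) divide_nonneg_pos mult_nonneg_nonneg zero_le_power2)
    qed (use pos nn in auto)
    moreover have "((norm (x t))\<^sup>2 - (norm xs)\<^sup>2) / 2 = U / 2 + xs \<bullet> u t"
      using half_norm_square_diff by (simp add: U_def)
    moreover have "\<kappa> / 2 * (\<eta>2 * U) = 2 * (\<kappa> * \<eta>2 / 4 * U)"
      by simp
    moreover have "M / (2 * g) = 2 * (1 / (4 * g) * M)" "M / (4 * g) = 1 / (4 * g) * M"
      using pos by (auto simp: field_simps)
    moreover have "\<omega> * (W + \<kappa>\<^sup>2 * U + M / 2) = \<omega> * W + \<omega> * \<kappa>\<^sup>2 * U + \<omega> / 2 * M"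
      by (simp add: algebra_simps)
    moreover have "- \<tau> \<le> a t * gap (x t) / 2 + \<rho> / 2 * (a t * (norm (A *v u t))\<^sup>2) + U / 2 + xs \<bullet> u t"
      using elim(2) by (simp add: U_def algebra_simps)
    ultimately show ?case
      using cross unfolding energy_def U_def[symmetric] W_def[symmetric] M_def[symmetric] abs_le_iff
      by linarith
  qed
qed

text \<open>The two dissipation estimates, added with a small weight \<open>\<xi>\<close> and
  compared with \<open>energy_le\<close>, give the hypothesis of
  \<open>gronwall_limsup_nonpos\<close> for every forcing level.\<close>

lemma energy_vanishes: "\<exists>\<xi>>0. \<forall>\<tau>>0. \<forall>\<^sub>F t in at_top. energy \<xi> t < \<tau>"
proof -
  obtain C where "C \<ge> 0" and C: "\<And>e p \<theta> y v \<mu>. 0 < e \<Longrightarrow> e \<le> 1 \<Longrightarrow> 0 \<le> p \<Longrightarrow> p \<le> \<kappa> \<Longrightarrow> 0 \<le> \<theta> \<Longrightarrow> \<theta> \<le> 1 \<Longrightarrow>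
    e\<^sup>2 * ((A *v accel \<delta> \<rho> e p \<theta> y v \<mu>) \<bullet> \<mu>) + g * ((A *v v) \<bullet> (A *v (\<kappa> *\<^sub>R (y - xs) + v)))
      - e\<^sup>2 * p * ((A *v v) \<bullet> \<mu>)
    \<le> - (norm (transpose A *v \<mu>))\<^sup>2 / 2 + C * ((norm (y - xs))\<^sup>2 + (norm v)\<^sup>2) + e ^ 4 * (norm xs)\<^sup>2"
    using cross_term_dissipation[of \<kappa> \<rho> g \<delta>] pos by (metis less_imp_le)
  obtain K where K: "K > 0" "\<And>y. norm (A *v y) \<le> norm y * K"
    using bounded_linear.pos_bounded[OF matrix_vector_mul_bounded_linear[of A]] by blast
  obtain k where "k > 0" and k: "\<And>q. q \<in> range ((*v) A) \<Longrightarrow> k * norm q \<le> norm (transpose A *v q)"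
    using transpose_bounded_below_on_range[of A] by blast
  \<comment> \<open>Budget for the cross term: half of the dissipation in \<open>v\<close> and a
    third of that in \<open>u\<close>.\<close>
  define m0 where "m0 = min (\<eta>2 / 2) (\<kappa> / 4)"
  define \<xi> where "\<xi> = m0 / (C + 1)"
  have "m0 > 0" using pos by (simp add: m0_def)
  then have "\<xi> > 0" using \<open>C \<ge> 0\<close> by (simp add: \<xi>_def)
  have "\<xi> * C \<le> m0"
    using \<open>m0 > 0\<close> \<open>C \<ge> 0\<close> by (simp add: \<xi>_def field_simps)
  then have \<xi>C: "\<xi> * C \<le> \<eta>2 / 2" "\<xi> * C \<le> \<kappa> / 4" by (auto simp: m0_def)
  define C4 where "C4 = \<kappa>\<^sup>2 + 2 + 1 / (2 * g) + \<kappa> * \<delta> / 2 + \<xi> * K"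
  have "C4 > 0"
    using pos K \<open>\<xi> > 0\<close> unfolding C4_def by (intro add_nonneg_pos add_pos_pos) auto
  \<comment> \<open>Budget for \<open>c\<close> times the energy: the other half in
    \<open>v\<close>, a further \<open>\<kappa> / 4\<close> in \<open>u\<close>, and the dissipation
    gained in \<open>\<mu>\<close>.\<close>
  define m where "m = min (\<eta>2 / 2) (min (\<kappa> / 4) (\<xi> * k\<^sup>2 / 2))"
  define c where "c = min (min (\<eta>1 / 2) (\<kappa> / 4)) (m / C4)"
  have "m > 0" using pos \<open>\<xi> > 0\<close> \<open>k > 0\<close> by (simp add: m_def)
  have "c > 0" using pos \<open>m > 0\<close> \<open>C4 > 0\<close> by (simp add: c_def)
  have "c \<le> min (min (\<eta>1 / 2) (\<kappa> / 4)) (m / C4)" by (simp add: c_def)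
  then have c: "c \<le> \<eta>1 / 2" "c \<le> \<kappa> / 4" "c \<le> m / C4"
    unfolding min.bounded_iff by blast+
  have "c * C4 \<le> m"
    using c(3) \<open>C4 > 0\<close> by (simp add: pos_le_divide_eq)
  then have cC4: "c * C4 \<le> \<eta>2 / 2" "c * C4 \<le> \<kappa> / 4" "c * C4 \<le> \<xi> * k\<^sup>2 / 2"
    unfolding m_def min.bounded_iff by blast+
  show ?thesis
  proof (intro exI[of _ \<xi>] conjI allI impI)
    show "\<xi> > 0" by fact
    fix \<tau> :: real assume "\<tau> > 0"
    show "\<forall>\<^sub>F t in at_top. energy \<xi> t < \<tau>"
    proof (rule gronwall_limsup_nonpos[OF \<open>c > 0\<close> E_lim E_deriv energy_deriv _ \<open>\<tau> > 0\<close>])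
      fix \<tau> :: real assume "\<tau> > 0"
      have "((\<lambda>t. \<xi> * (e t ^ 4 * (norm xs)\<^sup>2)) \<longlongrightarrow> \<xi> * (0 ^ 4 * (norm xs)\<^sup>2)) at_top"
        by (intro tendsto_intros e_lim)
      then have "\<forall>\<^sub>F t in at_top. \<xi> * (e t ^ 4 * (norm xs)\<^sup>2) < \<tau> / 2"
        using \<open>\<tau> > 0\<close> by (intro order_tendstoD(2)[of _ 0]) auto
      moreover have "\<forall>\<^sub>F t in at_top. e t < 1"
        using e_lim by (rule order_tendstoD) simp
      moreover have "\<forall>\<^sub>F t in at_top. \<beta> t * e t < min 1 (1 / \<kappa>)"
        using theta_lim by (rule order_tendstoD) (use pos in simp)
      \<comment> \<open>Adding \<open>c * energy \<xi> t\<close> changes the coefficient of the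
        forcing from \<open>- \<kappa>\<close> to \<open>c - \<kappa>\<close>. Half of the
        dissipation of gap and residual and the last \<open>\<kappa> / 4\<close> in \<open>u\<close>
        are reserved to dominate it.\<close>
      moreover have "\<forall>\<^sub>F t in at_top. - (\<tau> / 2) \<le> a t * (\<eta>1 / 2 * gap (x t) + \<rho> * \<kappa> / 8 * (norm (A *v u t))\<^sup>2)
        + \<kappa> / 4 * (norm (u t))\<^sup>2 + (\<kappa> - c) * (xs \<bullet> u t)"
        by (rule eventually_penalty_lower_bound) (use pos \<open>\<tau> > 0\<close> c in auto)
      ultimately show "\<forall>\<^sub>F t in at_top. e t * (
          (\<kappa> *\<^sub>R u t + v t) \<bullet> (\<kappa> *\<^sub>R v t + acc t)
          + a t * (\<mu> t \<bullet> (A *v (\<kappa> *\<^sub>R u t + v t)))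
          + a t * (p t * gap (x t) + (grad (x t) - grad xs) \<bullet> v t)
          + \<rho> * a t * (p t / 2 * (norm (A *v u t))\<^sup>2 + (A *v u t) \<bullet> (A *v v t))
          + x t \<bullet> v t
          + \<kappa> * ((\<delta> - \<kappa> - p t / 2) * (u t \<bullet> v t) - p' t / 4 * (norm (u t))\<^sup>2)
          + \<xi> * ((e t)\<^sup>2 * ((A *v acc t) \<bullet> \<mu> t) + g * ((A *v v t) \<bullet> (A *v (\<kappa> *\<^sub>R u t + v t)))
              - (e t)\<^sup>2 * p t * ((A *v v t) \<bullet> \<mu> t)))
        \<le> e t * (\<tau> - c * energy \<xi> t)"
        (is "\<forall>\<^sub>F t in at_top. e t * (?M t + \<xi> * ?X t) \<le> _")
        using eventually_ge_at_top[of T]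
      proof eventually_elim
        case (elim t)
        note t = elim(5)
        define U where "U = (norm (u t))\<^sup>2"
        define N where "N = (norm (v t))\<^sup>2"
        define M where "M = (norm (\<mu> t))\<^sup>2"
        define F where "F = a t * gap (x t)"
        define R where "R = a t * (norm (A *v u t))\<^sup>2"
        have nn: "U \<ge> 0" "N \<ge> 0" "M \<ge> 0" "F \<ge> 0" "R \<ge> 0"
          using a_pos[OF t] gap_nonneg by (auto simp: U_def N_def M_def F_def R_def)
        have \<theta>: "\<beta> t * e t \<ge> 0" "\<beta> t * e t \<le> 1" "\<kappa> * (\<beta> t * e t) \<le> 1"
          using elim(3) pos \<beta>_nonneg[OF t] e_pos[OF t] by (auto simp: field_simps)
        have "?M t \<le> - \<eta>1 * F - \<rho> * \<kappa> / 4 * R - \<eta>2 * N - 3 * \<kappa> / 4 * U - \<kappa> * (xs \<bullet> u t)"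
          unfolding F_def R_def N_def U_def acc_def u_def a_def
          by (rule energy_dissipation)
             (use e_pos[OF t] \<beta>_nonneg[OF t] pos p_nonneg[OF t] p_le[OF t] \<theta> damping[OF t] p'_le[OF t] in auto)
        moreover have "\<xi> * ?X t \<le> \<xi> * (- (norm (transpose A *v \<mu> t))\<^sup>2 / 2 + C * (U + N) + e t ^ 4 * (norm xs)\<^sup>2)"
          unfolding N_def U_def acc_def u_def
          by (intro mult_left_mono C) (use e_pos[OF t] elim(2) \<theta> p_nonneg[OF t] p_le[OF t] pos \<open>\<xi> > 0\<close> in auto)
        moreover have "\<xi> * (k\<^sup>2 * M) \<le> \<xi> * (norm (transpose A *v \<mu> t))\<^sup>2"
          using k[of "\<mu> t"] lam_range[OF t] \<open>k > 0\<close> \<open>\<xi> > 0\<close> unfolding M_def power_mult_distrib[symmetric]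
          by (intro mult_left_mono power_mono) (auto simp: \<mu>_def)
        moreover have "c * energy \<xi> t \<le> c * (F + \<rho> / 2 * R + xs \<bullet> u t + C4 * (U + N + M))"
          unfolding F_def R_def U_def N_def M_def C4_def
          by (intro mult_left_mono energy_le K) (use t elim(2) \<open>\<xi> > 0\<close> \<open>c > 0\<close> in auto)
        moreover have "0 \<le> \<rho> / 2 * R"
          using nn pos by simp
        note mult_right_mono[OF c(1) nn(4)] mult_right_mono[OF c(2) this]
          mult_right_mono[OF cC4(2) nn(1)] mult_right_mono[OF cC4(1) nn(2)] mult_right_mono[OF cC4(3) nn(3)]
          mult_right_mono[OF \<xi>C(2) nn(1)] mult_right_mono[OF \<xi>C(1) nn(2)]
        moreover have "- (\<tau> / 2) \<le> \<eta>1 / 2 * F + \<rho> * \<kappa> / 8 * R + \<kappa> / 4 * U + (\<kappa> - c) * (xs \<bullet> u t)"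
          using elim(4) by (simp add: F_def R_def U_def distrib_left mult_ac)
        ultimately have "?M t + \<xi> * ?X t \<le> \<tau> - c * energy \<xi> t"
          using elim(1) by (simp add: distrib_left distrib_right left_diff_distrib right_diff_distrib mult_ac)
        then show ?case
          using e_pos[OF t] by (intro mult_left_mono) auto
      qed
    qed auto
  qed
qed

section \<open>Limits of the energy terms and of the scaled residual\<close>

lemma energy_parts_tendsto:
  "((\<lambda>t. 1 / 4 * (norm (w t))\<^sup>2 + 1 / (4 * g) * (norm (\<mu> t))\<^sup>2 + 1 / 2 * (a t * gap (x t))
     + \<kappa> * \<eta>2 / 4 * (norm (u t))\<^sup>2) \<longlongrightarrow> 0) at_top" (is "(?Q \<longlongrightarrow> 0) at_top")
proof (rule order_tendstoI)
  fix \<tau> :: real assume "\<tau> < 0"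
  show "\<forall>\<^sub>F t in at_top. \<tau> < ?Q t"
    using eventually_ge_at_top[of T]
  proof eventually_elim
    case (elim t)
    have "0 \<le> ?Q t"
      using a_pos[OF elim] gap_nonneg[of "x t"] pos by (intro add_nonneg_nonneg) auto
    with \<open>\<tau> < 0\<close> show ?case by linarith
  qed
next
  fix \<tau> :: real assume "0 < \<tau>"
  obtain \<xi> where "\<xi> > 0" and \<xi>: "\<And>\<tau>. \<tau> > 0 \<Longrightarrow> \<forall>\<^sub>F t in at_top. energy \<xi> t < \<tau>"
    using energy_vanishes by blast
  have "\<forall>\<^sub>F t in at_top. energy \<xi> t < \<tau> / 2"
    by (rule \<xi>) (use \<open>0 < \<tau>\<close> in simp)
  moreover have "\<forall>\<^sub>F t in at_top. ?Q t \<le> energy \<xi> t + \<tau> / 2"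
    using energy_ge[of \<xi> "\<tau> / 2"] \<open>0 < \<tau>\<close> \<open>\<xi> > 0\<close> by simp
  ultimately show "\<forall>\<^sub>F t in at_top. ?Q t < \<tau>"
    by eventually_elim linarith
qed

text \<open>The nonnegativity facts are premises of \<open>le\<close>, so that singling out one
  summand is linear arithmetic.\<close>

lemma tendsto_zero_of_energy_part:
  assumes "c > 0" "\<And>t. t \<ge> T \<Longrightarrow> 0 \<le> h t"
    and le: "\<And>t. t \<ge> T \<Longrightarrow> 0 \<le> 1 / 4 * (norm (w t))\<^sup>2 \<Longrightarrow> 0 \<le> 1 / (4 * g) * (norm (\<mu> t))\<^sup>2 \<Longrightarrow>
        0 \<le> 1 / 2 * (a t * gap (x t)) \<Longrightarrow> 0 \<le> \<kappa> * \<eta>2 / 4 * (norm (u t))\<^sup>2 \<Longrightarrow>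
      c * h t \<le> 1 / 4 * (norm (w t))\<^sup>2 + 1 / (4 * g) * (norm (\<mu> t))\<^sup>2 + 1 / 2 * (a t * gap (x t))
        + \<kappa> * \<eta>2 / 4 * (norm (u t))\<^sup>2"
  shows "(h \<longlongrightarrow> 0) at_top"
proof -
  have "((\<lambda>t. c * h t) \<longlongrightarrow> 0) at_top"
  proof (rule tendsto_sandwich[OF _ _ tendsto_const energy_parts_tendsto])
    show "\<forall>\<^sub>F t in at_top. 0 \<le> c * h t"
      using assms by (intro eventually_mono[OF eventually_ge_at_top[of T]]) auto
    show "\<forall>\<^sub>F t in at_top. c * h t \<le> 1 / 4 * (norm (w t))\<^sup>2 + 1 / (4 * g) * (norm (\<mu> t))\<^sup>2
        + 1 / 2 * (a t * gap (x t)) + \<kappa> * \<eta>2 / 4 * (norm (u t))\<^sup>2"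
      by (rule eventually_mono[OF eventually_ge_at_top[of T]], rule le)
         (use pos a_pos gap_nonneg in \<open>auto intro: mult_nonneg_nonneg less_imp_le\<close>)
  qed
  then have "((\<lambda>t. inverse c * (c * h t)) \<longlongrightarrow> inverse c * 0) at_top"
    by (rule tendsto_mult_left)
  then show ?thesis
    using \<open>c > 0\<close> by (simp flip: mult.assoc)
qed

lemma scaled_gap_tendsto: "((\<lambda>t. gap (x t) / (e t)\<^sup>2) \<longlongrightarrow> 0) at_top"
proof -
  have "((\<lambda>t. a t * gap (x t)) \<longlongrightarrow> 0) at_top"
    by (rule tendsto_zero_of_energy_part[of "1 / 2"])
       (linarith | use a_pos gap_nonneg in \<open>simp add: less_imp_le\<close>)+
  then show ?thesis
    by (simp add: a_def)
qed

lemma w_tendsto: "(w \<longlongrightarrow> 0) at_top"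
  by (rule tendsto_zero_of_norm_square, rule tendsto_zero_of_energy_part[of "1 / 4"])
     (linarith | simp)+

lemma \<mu>_tendsto: "(\<mu> \<longlongrightarrow> 0) at_top"
  by (rule tendsto_zero_of_norm_square, rule tendsto_zero_of_energy_part[of "1 / (4 * g)"])
     (linarith | use pos in simp)+

lemma u_tendsto: "(u \<longlongrightarrow> 0) at_top"
  by (rule tendsto_zero_of_norm_square, rule tendsto_zero_of_energy_part[of "\<kappa> * \<eta>2 / 4"])
     (linarith | use pos in simp)+

lemma velocity_tendsto: "(v \<longlongrightarrow> 0) at_top"
proof -
  have "((\<lambda>t. w t - \<kappa> *\<^sub>R u t) \<longlongrightarrow> 0 - \<kappa> *\<^sub>R 0) at_top"
    by (intro tendsto_intros w_tendsto u_tendsto)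
  then show ?thesis
    by (simp add: w_def)
qed

text \<open>Penalty estimates give only \<open>o(e)\<close> for the residual. Subtracting the multiplier from the
  scaled residual removes the velocity from its equation and leaves a damped linear one forced by
  the multiplier.\<close>

lemma scaled_residual_tendsto: "((\<lambda>t. (1 / (e t)\<^sup>2) *\<^sub>R (A *v x t - b)) \<longlongrightarrow> 0) at_top"
proof -
  define Q where "Q t = a t *\<^sub>R (A *v u t) - (1 / g) *\<^sub>R \<mu> t" for t
  have Q_deriv: "((\<lambda>t. (norm (Q t))\<^sup>2) has_real_derivative
      e t * (- 2 * (\<kappa> - p t) * ((norm (Q t))\<^sup>2 + (Q t \<bullet> \<mu> t) / g))) (at t)" if t: "t \<ge> T" for t
  proof -
    have "(Q has_vector_derivative a t *\<^sub>R (e t *\<^sub>R (A *v v t)) + (e t * (p t * a t)) *\<^sub>R (A *v u t)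
        - (1 / g) *\<^sub>R (e t *\<^sub>R ((g * a t) *\<^sub>R (A *v w t)))) (at t)"
      unfolding Q_def
      by (intro has_vector_derivative_diff has_vector_derivative_scaleR a_deriv[OF t] Au_deriv[OF t]
          bounded_linear.has_vector_derivative[OF bounded_linear_scaleR_right] \<mu>_deriv[OF t])
    \<comment> \<open>Since \<open>A *v w t\<close> is
      \<open>\<kappa> *\<^sub>R (A *v u t) + A *v v t\<close>, the velocity drops out; what is left
      is a multiple of \<open>a t *\<^sub>R (A *v u t)\<close>, rewritten through
      \<open>Q\<close>.\<close>
    also have "a t *\<^sub>R (e t *\<^sub>R (A *v v t)) + (e t * (p t * a t)) *\<^sub>R (A *v u t)
        - (1 / g) *\<^sub>R (e t *\<^sub>R ((g * a t) *\<^sub>R (A *v w t)))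
      = (- e t * (\<kappa> - p t)) *\<^sub>R (Q t + (1 / g) *\<^sub>R \<mu> t)"
      using pos by (simp add: Q_def w_def matrix_vector_right_distrib matrix_vector_mult_scaleR
          algebra_simps)
    finally have "(Q has_vector_derivative (- e t * (\<kappa> - p t)) *\<^sub>R (Q t + (1 / g) *\<^sub>R \<mu> t)) (at t)" .
    from has_real_derivative_inner[OF this this] show ?thesis
      unfolding power2_norm_eq_inner
      by (rule DERIV_cong) (simp add: inner_add_right inner_add_left inner_commute algebra_simps)
  qed
  have "\<forall>\<^sub>F t in at_top. (norm (Q t))\<^sup>2 < \<tau>" if "\<tau> > 0" for \<tau>
  proof (rule gronwall_limsup_nonpos[OF pos(5) E_lim E_deriv Q_deriv _ that])
    fix \<tau> :: real assume "\<tau> > 0"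
    have "((\<lambda>t. \<kappa> / g\<^sup>2 * (norm (\<mu> t))\<^sup>2) \<longlongrightarrow> \<kappa> / g\<^sup>2 * (norm (0 :: real ^ 'm))\<^sup>2) at_top"
      by (intro tendsto_intros \<mu>_tendsto)
    then have "\<forall>\<^sub>F t in at_top. \<kappa> / g\<^sup>2 * (norm (\<mu> t))\<^sup>2 < \<tau>"
      using \<open>\<tau> > 0\<close> by (simp add: order_tendstoD)
    then show "\<forall>\<^sub>F t in at_top. e t * (- 2 * (\<kappa> - p t) * ((norm (Q t))\<^sup>2 + (Q t \<bullet> \<mu> t) / g))
        \<le> e t * (\<tau> - \<eta>1 * (norm (Q t))\<^sup>2)"
      using eventually_ge_at_top[of T]
    proof eventually_elim
      case (elim t)
      define s where "s = \<kappa> - p t"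
      have s: "\<eta>1 \<le> s" "s \<le> \<kappa>"
        using p_le[OF elim(2)] p_nonneg[OF elim(2)] by (auto simp: s_def)
      \<comment> \<open>This square absorbs the product of \<open>Q\<close> and
        \<open>\<mu>\<close>: half of the damping of \<open>Q\<close> survives, against a forcing by
        \<open>(norm (\<mu> t))\<^sup>2 / g\<^sup>2\<close>.\<close>
      have "0 \<le> (norm (Q t + (1 / g) *\<^sub>R \<mu> t))\<^sup>2" by simp
      also have "\<dots> = (norm (Q t))\<^sup>2 + 2 * ((Q t \<bullet> \<mu> t) / g) + (norm (\<mu> t))\<^sup>2 / g\<^sup>2"
        by (simp add: power2_norm_eq_inner inner_add_left inner_add_right inner_commute power2_eq_square[of g])
      finally have "s * (- 2 * ((norm (Q t))\<^sup>2 + (Q t \<bullet> \<mu> t) / g))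
          \<le> s * ((norm (\<mu> t))\<^sup>2 / g\<^sup>2 - (norm (Q t))\<^sup>2)"
        using s pos by (intro mult_left_mono) auto
      moreover have "s * ((norm (\<mu> t))\<^sup>2 / g\<^sup>2) \<le> \<kappa> * ((norm (\<mu> t))\<^sup>2 / g\<^sup>2)"
        using s by (intro mult_right_mono) auto
      moreover have "\<eta>1 * (norm (Q t))\<^sup>2 \<le> s * (norm (Q t))\<^sup>2"
        using s by (intro mult_right_mono) auto
      moreover have "\<kappa> * ((norm (\<mu> t))\<^sup>2 / g\<^sup>2) < \<tau>"
        using elim(1) by simp
      ultimately have "s * (- 2 * ((norm (Q t))\<^sup>2 + (Q t \<bullet> \<mu> t) / g)) \<le> \<tau> - \<eta>1 * (norm (Q t))\<^sup>2"
        unfolding right_diff_distrib by linarith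
      moreover have "- 2 * s * ((norm (Q t))\<^sup>2 + (Q t \<bullet> \<mu> t) / g)
          = s * (- 2 * ((norm (Q t))\<^sup>2 + (Q t \<bullet> \<mu> t) / g))"
        by (simp only: mult_ac)
      ultimately have "- 2 * s * ((norm (Q t))\<^sup>2 + (Q t \<bullet> \<mu> t) / g) \<le> \<tau> - \<eta>1 * (norm (Q t))\<^sup>2"
        by argo
      then show ?case
        unfolding s_def using e_pos[OF elim(2)] by (intro mult_left_mono) auto
    qed
  qed auto
  then have "((\<lambda>t. (norm (Q t))\<^sup>2) \<longlongrightarrow> 0) at_top"
    by (intro order_tendstoI) (auto intro!: always_eventually intro: less_le_trans)
  then have "(Q \<longlongrightarrow> 0) at_top"
    by (rule tendsto_zero_of_norm_square)
  then have "((\<lambda>t. Q t + (1 / g) *\<^sub>R \<mu> t) \<longlongrightarrow> 0 + (1 / g) *\<^sub>R 0) at_top"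
    by (intro tendsto_intros \<mu>_tendsto)
  then show ?thesis
    by (simp add: Q_def a_def u_def matrix_vector_mult_diff_distrib feasible)
qed

end

section \<open>Reduction of the original system to the new time\<close>

lemma closed_convex_solution_set:
  fixes f :: "real ^ 'n \<Rightarrow> real" and A :: "real ^ 'n ^ 'm"
  assumes convex: "convex_on UNIV f" and cont: "continuous_on UNIV f"
  shows "closed (solution_set f A b)" "convex (solution_set f A b)"
proof -
  have "closed (solution_set f A b) \<and> convex (solution_set f A b)"
  proof (cases "solution_set f A b = {}")
    case False
    then obtain z where z: "A *v z = b" "\<And>y. A *v y = b \<Longrightarrow> f z \<le> f y"
      by (force simp: solution_set_def is_arg_min_def)
    \<comment> \<open>With \<open>f z\<close> the optimal value, the solutions are the feasible
      points of a sublevel set of \<open>f\<close>.\<close>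
    have eq: "solution_set f A b = {x. A *v x = b} \<inter> {x \<in> UNIV. f x \<le> f z}"
      using z by (fastforce simp: solution_set_def is_arg_min_def)
    have "closed {x. A *v x = b}"
      by (intro closed_Collect_eq continuous_intros)
    moreover have "closed {x \<in> UNIV. f x \<le> f z}"
      using cont by (auto intro!: closed_Collect_le continuous_intros)
    moreover have "convex {x. A *v x = b}"
      by (auto simp: convex_def matrix_vector_right_distrib matrix_vector_mult_scaleR
          simp flip: scaleR_left_distrib)
    moreover have "convex {x \<in> UNIV. f x \<le> f z}"
    proof (rule convexI)
      fix x y and u v :: real
      assume "x \<in> {x \<in> UNIV. f x \<le> f z}" "y \<in> {x \<in> UNIV. f x \<le> f z}" "0 \<le> u" "0 \<le> v" "u + v = 1"
      then show "u *\<^sub>R x + v *\<^sub>R y \<in> {x \<in> UNIV. f x \<le> f z}"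
        using convex_lower[OF convex, of x y u v] by simp
    qed
    ultimately show ?thesis
      unfolding eq by (intro conjI closed_Int convex_Int) simp_all
  qed simp
  then show "closed (solution_set f A b)" "convex (solution_set f A b)" by auto
qed

text \<open>The increment of \<open>lam\<close> is \<open>A\<close> applied to the integral of
  \<open>c\<close>, and the range of \<open>A\<close> is a subspace.\<close>

lemma diff_in_range_of_derivative_in_range:
  fixes lam :: "real \<Rightarrow> real ^ 'm" and A :: "real ^ 'n ^ 'm"
  assumes deriv: "\<And>t. t \<ge> t0 \<Longrightarrow> (lam has_vector_derivative A *v c t) (at t within {t0..})"
    and cont: "continuous_on {t0..} c" and "lam t0 - q \<in> range ((*v) A)" and "t \<ge> t0"
  shows "lam t - q \<in> range ((*v) A)"
proof -
  obtain z where z: "lam t0 - q = A *v z"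
    using assms(3) by blast
  have "(lam has_vector_derivative A *v c s) (at s within {t0..t})" if "s \<in> {t0..t}" for s
    using that by (intro has_vector_derivative_within_subset[OF deriv]) auto
  then have "((\<lambda>s. A *v c s) has_integral lam t - lam t0) {t0..t}"
    by (rule fundamental_theorem_of_calculus[OF \<open>t \<ge> t0\<close>])
  moreover have "(c has_integral integral {t0..t} c) {t0..t}"
    by (intro integrable_integral integrable_continuous_interval continuous_on_subset[OF cont]) auto
  then have "((\<lambda>s. A *v c s) has_integral A *v integral {t0..t} c) {t0..t}"
    using has_integral_linear[OF _ matrix_vector_mul_bounded_linear[of A]] by (force simp: o_def)
  ultimately have "lam t - lam t0 = A *v integral {t0..t} c"
    by (rule has_integral_unique)
  then have "lam t - q = A *v (z + integral {t0..t} c)"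
    using z by (simp add: matrix_vector_right_distrib algebra_simps)
  then show ?thesis by blast
qed

theorem theorem4p2:
  fixes f :: "real ^ 'n \<Rightarrow> real" and grad :: "real ^ 'n \<Rightarrow> real ^ 'n"
    and A :: "real ^ 'n ^ 'm" and b :: "real ^ 'm"
    and t0 L \<delta> \<rho> \<sigma> \<gamma> :: real
    and \<epsilon> \<epsilon>' \<epsilon>'' \<beta> :: "real \<Rightarrow> real"
    and x x' x'' :: "real \<Rightarrow> real ^ 'n" and lam lam' :: "real \<Rightarrow> real ^ 'm"
    and xstar :: "real ^ 'n" and lamdag :: "real ^ 'm"
  assumes "t0 > 0"
    and f_convex: "convex_on UNIV f"
    and f_grad: "\<And>z. GDERIV f z :> grad z"
    and grad_cont: "continuous_on UNIV grad"
    and "L > 0" and grad_lipschitz: "L-lipschitz_on UNIV grad"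
    and "\<delta> > 0" "\<rho> > 0" "\<sigma> > 0" "\<gamma> > 0"
    and eps_pos: "\<And>t. t \<ge> t0 \<Longrightarrow> \<epsilon> t > 0"
    and eps_deriv: "\<And>t. t \<ge> t0 \<Longrightarrow> (\<epsilon> has_real_derivative \<epsilon>' t) (at t within {t0..})"
    and eps_deriv2: "\<And>t. t \<ge> t0 \<Longrightarrow> (\<epsilon>' has_real_derivative \<epsilon>'' t) (at t within {t0..})"
    and eps_C2: "continuous_on {t0..} \<epsilon>''"
    and eps_decreasing: "antimono_on {t0..} \<epsilon>"
    and eps_lim: "(\<epsilon> \<longlongrightarrow> 0) at_top"
    and beta_nonneg: "\<And>t. t \<ge> t0 \<Longrightarrow> \<beta> t \<ge> 0"
    and beta_cont: "continuous_on {t0..} \<beta>"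
    and beta_bounded: "bounded (\<beta> ` {t0..})"
    and S_nonempty: "solution_set f A b \<noteq> {}"
    and x_deriv: "\<And>t. t \<ge> t0 \<Longrightarrow> (x has_vector_derivative x' t) (at t within {t0..})"
    and x_deriv2: "\<And>t. t \<ge> t0 \<Longrightarrow> (x' has_vector_derivative x'' t) (at t within {t0..})"
    and x_C2: "continuous_on {t0..} x''"
    and lam_deriv: "\<And>t. t \<ge> t0 \<Longrightarrow> (lam has_vector_derivative lam' t) (at t within {t0..})"
    and lam_C1: "continuous_on {t0..} lam'"
    and ode_x: "\<And>t. t \<ge> t0 \<Longrightarrow>
      x'' t + (\<delta> * sqrt (\<epsilon> t)) *\<^sub>R x' t + grad (x t + \<beta> t *\<^sub>R x' t) + transpose A *v lam t
        + \<rho> *\<^sub>R (transpose A *v (A *v (x t + \<beta> t *\<^sub>R x' t) - b)) + \<epsilon> t *\<^sub>R x t = 0"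
    and ode_lam: "\<And>t. t \<ge> t0 \<Longrightarrow>
      lam' t = (\<gamma> / sqrt (\<epsilon> t)) *\<^sub>R (A *v (x t + (\<gamma> / (\<sigma> * sqrt (\<epsilon> t))) *\<^sub>R x' t) - b)"
    and xstar: "xstar = closest_point (solution_set f A b) 0"
    and lamdag_stationary: "grad xstar + transpose A *v lamdag = 0"
    and lamdag_range: "lam t0 - lamdag \<in> range (\<lambda>z. A *v z)"
    and conditions: "\<exists>sT\<in>new_times t0 \<epsilon>. \<exists>\<eta>1>0. \<exists>\<eta>2>0. \<forall>s\<in>new_times t0 \<epsilon>. s \<ge> sT \<longrightarrow>
      p_fun t0 \<epsilon> s < 2 * (\<delta> - \<sigma> / \<gamma>) \<and>
      \<sigma> / \<gamma> - p_fun t0 \<epsilon> s \<ge> \<eta>1 \<and>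
      \<delta> - \<sigma> / \<gamma> - p_fun t0 \<epsilon> s / 2 - \<sigma> * L / (2 * \<gamma>) * (\<beta> (old_time t0 \<epsilon> s))\<^sup>2 \<ge> \<eta>2 \<and>
      \<sigma> / (4 * \<gamma>) * max (- p_deriv t0 \<epsilon> s) 0 \<le> (\<sigma> / \<gamma> + p_fun t0 \<epsilon> s) / 8"
  shows "(\<lambda>t. norm (x' t)) \<in> o(\<lambda>t. sqrt (\<epsilon> t)) \<and>
    (\<lambda>t. lagrangian f A b (x t) lamdag - lagrangian f A b xstar lamdag) \<in> o(\<epsilon>) \<and>
    (\<lambda>t. norm (A *v x t - b)) \<in> o(\<epsilon>) \<and>
    (\<lambda>t. \<bar>f (x t) - f xstar\<bar>) \<in> o(\<epsilon>)"
proof -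
  have f_cont: "continuous_on UNIV f"
    using f_grad by (rule GDERIV_continuous_on)
  note S = closed_convex_solution_set[OF f_convex f_cont, of A b]
  have "xstar \<in> solution_set f A b"
    unfolding xstar by (intro closest_point_in_set S S_nonempty)
  then have feasible: "A *v xstar = b" and optimal: "\<And>y. A *v y = b \<Longrightarrow> f xstar \<le> f y"
    by (force simp: solution_set_def is_arg_min_def)+
  interpret linearly_constrained_problem f grad A b L xstar lamdag
  proof
    fix y assume y: "A *v y = b" "f y \<le> f xstar"
    then have "y \<in> solution_set f A b"
      using optimal by (force simp: solution_set_def is_arg_min_def)
    then show "0 \<le> xstar \<bullet> (y - xstar)"
      using closest_point_dot[OF S(2,1), of y 0] unfolding xstar[symmetric] by simp
  qed (use f_convex f_grad grad_lipschitz lamdag_stationary feasible in auto)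

  have eps_cont: "continuous_on {t0..} \<epsilon>"
    using eps_deriv DERIV_continuous_on by (metis atLeast_iff)
  have x_cont: "continuous_on {t0..} x" "continuous_on {t0..} x'"
    unfolding continuous_on_eq_continuous_within
    using x_deriv x_deriv2 by (auto intro: has_vector_derivative_continuous)
  define e where "e t = sqrt (\<epsilon> t)" for t
  have e_pos: "e t > 0" and e_sq: "(e t)\<^sup>2 = \<epsilon> t" if "t \<ge> t0" for t
    using eps_pos[OF that] by (auto simp: e_def)
  define P where "P t = - \<epsilon>' t / e t ^ 3" for t
  define P' where "P' t = p_deriv t0 \<epsilon> (new_time t0 \<epsilon> t)" for t
  define v where "v t = (1 / e t) *\<^sub>R x' t" for t
  have x'_eq: "x' t = e t *\<^sub>R v t" if "t \<ge> t0" for t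
    using e_pos[OF that] by (simp add: v_def)
  obtain sT \<eta>1 \<eta>2 where sT: "sT \<in> new_times t0 \<epsilon>" and \<eta>: "\<eta>1 > 0" "\<eta>2 > 0" and cond:
    "\<And>s. s \<in> new_times t0 \<epsilon> \<Longrightarrow> s \<ge> sT \<Longrightarrow> \<sigma> / \<gamma> - p_fun t0 \<epsilon> s \<ge> \<eta>1 \<and>
      \<delta> - \<sigma> / \<gamma> - p_fun t0 \<epsilon> s / 2 - \<sigma> * L / (2 * \<gamma>) * (\<beta> (old_time t0 \<epsilon> s))\<^sup>2 \<ge> \<eta>2 \<and>
      \<sigma> / (4 * \<gamma>) * max (- p_deriv t0 \<epsilon> s) 0 \<le> (\<sigma> / \<gamma> + p_fun t0 \<epsilon> s) / 8"
    using conditions by blast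
  obtain tS where tS: "tS \<ge> t0" "sT = new_time t0 \<epsilon> tS"
    using sT by (auto simp: new_times_eq[OF eps_pos eps_cont])
  \<comment> \<open>One unit past \<open>tS\<close> lies to the right of \<open>t0\<close> even if
    \<open>tS = t0\<close>, so that derivatives within the half-line become two-sided.\<close>
  define T where "T = tS + 1"
  have T: "t > t0" "t \<ge> t0" "at t within {t0..} = at t" if "t \<ge> T" for t
    using that tS at_within_interior[of t "{t0..}"] by (auto simp: T_def)
  have P_cond: "\<sigma> / \<gamma> - P t \<ge> \<eta>1"
      "\<delta> - \<sigma> / \<gamma> - P t / 2 - \<sigma> * L / (2 * \<gamma>) * (\<beta> t)\<^sup>2 \<ge> \<eta>2"
      "\<sigma> / (4 * \<gamma>) * max (- P' t) 0 \<le> (\<sigma> / \<gamma> + P t) / 8" if "t \<ge> T" for t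
  proof -
    have "new_time t0 \<epsilon> t \<in> new_times t0 \<epsilon>"
      using T[OF that] by (auto simp: new_times_eq[OF eps_pos eps_cont])
    moreover have "new_time t0 \<epsilon> t \<ge> sT"
      using strict_mono_on_leD[OF new_time_strict_mono[OF eps_pos eps_cont], of tS t] that tS
      by (simp add: T_def)
    moreover have "p_fun t0 \<epsilon> (new_time t0 \<epsilon> t) = P t"
      using p_fun_new_time[OF eps_pos eps_cont _ eps_deriv] T[OF that] by (simp add: P_def e_def)
    moreover have "old_time t0 \<epsilon> (new_time t0 \<epsilon> t) = t"
      using T[OF that] by (simp add: old_time_new_time[OF eps_pos eps_cont])
    ultimately show "\<sigma> / \<gamma> - P t \<ge> \<eta>1"
      "\<delta> - \<sigma> / \<gamma> - P t / 2 - \<sigma> * L / (2 * \<gamma>) * (\<beta> t)\<^sup>2 \<ge> \<eta>2"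
      "\<sigma> / (4 * \<gamma>) * max (- P' t) 0 \<le> (\<sigma> / \<gamma> + P t) / 8"
      using cond[of "new_time t0 \<epsilon> t"] by (auto simp: P'_def)
  qed
  have e_deriv: "(e has_real_derivative - P t * (e t)\<^sup>2 / 2) (at t within {t0..})" if "t \<ge> t0" for t
    unfolding e_def
    by (rule DERIV_cong, rule DERIV_chain2[OF DERIV_real_sqrt[OF eps_pos[OF that]] eps_deriv[OF that]])
       (use e_pos[OF that] in \<open>simp add: P_def e_def[symmetric] field_simps power2_eq_square power3_eq_cube\<close>)
  have P_deriv: "(P has_real_derivative e t * P' t) (at t within {t0..})" if "t \<ge> t0" for t
  proof -
    have "e t ^ 3 \<noteq> 0"
      using e_pos[OF that] by simp
    \<comment> \<open>The quotient rule provides some derivative \<open>D\<close>; its value need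
      not be computed, because \<open>p_deriv_new_time\<close> identifies it as
      \<open>e t * P' t\<close>.\<close>
    from DERIV_divide[OF DERIV_minus[OF eps_deriv2[OF that]] DERIV_power[OF e_deriv[OF that], of 3] this]
    obtain D where D: "(P has_real_derivative D) (at t within {t0..})"
      unfolding P_def by blast
    then have "P' t = D / e t"
      unfolding P_def P'_def e_def by (intro p_deriv_new_time[where \<epsilon>' = \<epsilon>'] eps_pos eps_cont that eps_deriv)
    then show ?thesis
      using D e_pos[OF that] by simp
  qed
  have v_deriv: "(v has_vector_derivative
      e t *\<^sub>R accel \<delta> \<rho> (e t) (P t) (\<beta> t * e t) (x t) (v t) (lam t - lamdag)) (at t within {t0..})"
    if t: "t \<ge> t0" for t
  proof -
    have "((\<lambda>t. 1 / e t) has_real_derivative P t / 2) (at t within {t0..})"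
      using e_pos[OF t] by (auto intro!: derivative_eq_intros e_deriv[OF t] simp: power2_eq_square)
    then have "(v has_vector_derivative (1 / e t) *\<^sub>R x'' t + (P t / 2) *\<^sub>R x' t) (at t within {t0..})"
      unfolding v_def by (intro has_vector_derivative_scaleR x_deriv2[OF t])
    moreover have "(1 / e t) *\<^sub>R x'' t + (P t / 2) *\<^sub>R x' t
        = e t *\<^sub>R accel \<delta> \<rho> (e t) (P t) (\<beta> t * e t) (x t) (v t) (lam t - lamdag)"
    proof -
      \<comment> \<open>The forces that carry the factor \<open>1 / (e t)\<^sup>2\<close> in
        \<open>accel\<close>; stationarity and feasibility turn them into deviations from
        \<open>xstar\<close> and \<open>lamdag\<close>.\<close>
      define G where "G = grad (x t + \<beta> t *\<^sub>R x' t) + transpose A *v lam t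
        + \<rho> *\<^sub>R (transpose A *v (A *v (x t + \<beta> t *\<^sub>R x' t) - b))"
      have "x'' t + ((\<delta> * sqrt (\<epsilon> t)) *\<^sub>R x' t + G + \<epsilon> t *\<^sub>R x t) = 0"
        using ode_x[OF t] by (simp only: G_def add.assoc)
      then have x'': "x'' t = - (\<delta> * e t) *\<^sub>R x' t - G - (e t)\<^sup>2 *\<^sub>R x t"
        using e_sq[OF t] by (simp add: e_def eq_neg_iff_add_eq_0[symmetric])
      have "grad xstar = - (transpose A *v lamdag)"
        using lamdag_stationary by (simp add: eq_neg_iff_add_eq_0)
      then have "G = grad (x t + (\<beta> t * e t) *\<^sub>R v t) - grad xstar + transpose A *v (lam t - lamdag)
          + \<rho> *\<^sub>R (transpose A *v (A *v (x t - xstar) + (\<beta> t * e t) *\<^sub>R (A *v v t)))"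
        by (simp del: transpose_matrix_vector add: G_def x'_eq[OF t] feasible[symmetric]
            matrix_vector_right_distrib matrix_vector_mult_diff_distrib matrix_vector_mult_scaleR)
      then have acc_eq: "accel \<delta> \<rho> (e t) (P t) (\<beta> t * e t) (x t) (v t) (lam t - lamdag)
          = - (\<delta> - P t / 2) *\<^sub>R v t - (1 / (e t)\<^sup>2) *\<^sub>R G - x t"
        by (simp only: accel_def)
      show ?thesis
        unfolding x'' acc_eq using e_pos[OF t]
        by (simp add: x'_eq[OF t] scaleR_diff_right scaleR_add_left algebra_simps power2_eq_square)
    qed
    ultimately show ?thesis by simp
  qed
  have lam'_eq: "lam' t = A *v ((\<gamma> / e t) *\<^sub>R (x t - xstar + (\<gamma> / \<sigma>) *\<^sub>R v t))" if "t \<ge> t0" for t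
    using ode_lam[OF that]
    by (simp add: e_def v_def feasible[symmetric] matrix_vector_right_distrib
        matrix_vector_mult_diff_distrib matrix_vector_mult_scaleR)
  have lam_range: "lam t - lamdag \<in> range ((*v) A)" if "t \<ge> t0" for t
  proof (rule diff_in_range_of_derivative_in_range[where lam = lam])
    show "lam t0 - lamdag \<in> range ((*v) A)" "t0 \<le> t"
      by (fact lamdag_range, fact that)
    show "(lam has_vector_derivative A *v ((\<gamma> / e t) *\<^sub>R (x t - xstar + (\<gamma> / \<sigma>) *\<^sub>R v t)))
        (at t within {t0..})" if "t \<ge> t0" for t
      using lam_deriv[OF that] lam'_eq[OF that] by simp
    have "continuous_on {t0..} e"
      unfolding e_def by (intro continuous_intros eps_cont)
    then show "continuous_on {t0..} (\<lambda>t. (\<gamma> / e t) *\<^sub>R (x t - xstar + (\<gamma> / \<sigma>) *\<^sub>R v t))"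
      unfolding v_def using e_pos by (intro continuous_intros x_cont) (auto simp: less_imp_neq[symmetric])
  qed
  \<comment> \<open>The sign of \<open>P\<close> comes from the monotonicity of
    \<open>\<epsilon>\<close>.\<close>
  have eps'_nonpos: "\<epsilon>' t \<le> 0" if "t > t0" for t
  proof -
    have "((\<lambda>t. - \<epsilon> t) has_real_derivative - \<epsilon>' t) (at t)"
      using eps_deriv[of t] at_within_interior[of t "{t0..}"] that by (auto intro!: derivative_eq_intros)
    moreover have "mono_on {t0..} (\<lambda>t. - \<epsilon> t)"
      using eps_decreasing by (auto simp: monotone_on_def)
    ultimately show ?thesis
      using mono_on_imp_deriv_nonneg[of "{t0..}" "\<lambda>t. - \<epsilon> t" "- \<epsilon>' t" t] that by simp
  qed

  \<comment> \<open>Factoring \<open>\<gamma> / \<sigma>\<close> out of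
    \<open>x t - xstar + (\<gamma> / \<sigma>) *\<^sub>R v t\<close> in the multiplier equation
    produces both \<open>\<kappa> = \<sigma> / \<gamma>\<close> and
    \<open>g = \<gamma>\<^sup>2 / \<sigma>\<close>.\<close>
  interpret primal_dual_trajectory f grad A b L xstar lamdag T \<delta> \<rho> "\<sigma> / \<gamma>" "\<gamma>\<^sup>2 / \<sigma>" \<eta>1 \<eta>2
    e "new_time t0 \<epsilon>" P P' \<beta> x v lam
  proof
    show "(e \<longlongrightarrow> 0) at_top"
      unfolding e_def using tendsto_real_sqrt[OF eps_lim] by simp
    show "\<exists>B. \<forall>t\<ge>T. \<beta> t \<le> B"
    proof -
      obtain B where "\<And>y. y \<in> \<beta> ` {t0..} \<Longrightarrow> norm y \<le> B"
        using beta_bounded unfolding bounded_iff by blast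
      then show ?thesis
        using T(2) by (intro exI[of _ B]) (fastforce simp: abs_le_iff)
    qed
    fix t assume "T \<le> t"
    note T = T[OF this] and P_cond = P_cond[OF this]
    show "e t > 0" "\<beta> t \<ge> 0" "lam t - lamdag \<in> range ((*v) A)"
      using T e_pos beta_nonneg lam_range by auto
    show "(e has_real_derivative - P t * (e t)\<^sup>2 / 2) (at t)"
      using e_deriv[OF T(2)] T by simp
    show "(new_time t0 \<epsilon> has_real_derivative e t) (at t)"
      using new_time_deriv[OF eps_pos eps_cont T(2)] T by (simp add: e_def)
    show "P t \<ge> 0"
      using eps'_nonpos[OF T(1)] e_pos[OF T(2)] by (simp add: P_def divide_nonpos_nonneg)
    show "\<sigma> / \<gamma> - P t \<ge> \<eta>1" "\<delta> - \<sigma> / \<gamma> - P t / 2 - \<sigma> / \<gamma> * L / 2 * (\<beta> t)\<^sup>2 \<ge> \<eta>2"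
      "\<sigma> / \<gamma> / 4 * max (- P' t) 0 \<le> (\<sigma> / \<gamma> + P t) / 8"
      using P_cond by (simp_all add: mult_ac)
    show "(P has_real_derivative e t * P' t) (at t)"
      using P_deriv[OF T(2)] T by simp
    show "(x has_vector_derivative e t *\<^sub>R v t) (at t)"
      using x_deriv[OF T(2)] T x'_eq by simp
    show "(v has_vector_derivative
        e t *\<^sub>R accel \<delta> \<rho> (e t) (P t) (\<beta> t * e t) (x t) (v t) (lam t - lamdag)) (at t)"
      using v_deriv[OF T(2)] T by simp
    have "lam' t = (\<gamma>\<^sup>2 / \<sigma> / e t) *\<^sub>R (A *v ((\<sigma> / \<gamma>) *\<^sub>R (x t - xstar) + v t))"
      using lam'_eq[OF T(2)] \<open>\<sigma> > 0\<close> \<open>\<gamma> > 0\<close>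
      by (simp add: matrix_vector_right_distrib matrix_vector_mult_scaleR scaleR_add_right power2_eq_square)
    then show "(lam has_vector_derivative
        (\<gamma>\<^sup>2 / \<sigma> / e t) *\<^sub>R (A *v ((\<sigma> / \<gamma>) *\<^sub>R (x t - xstar) + v t))) (at t)"
      using lam_deriv[OF T(2)] T by simp
  qed (use \<open>\<delta> > 0\<close> \<open>\<rho> > 0\<close> \<open>\<sigma> > 0\<close> \<open>\<gamma> > 0\<close> \<eta> in auto)

  have ev: "\<forall>\<^sub>F t in at_top. t0 \<le> t"
    by (rule eventually_ge_at_top)
  have eps_ne: "\<forall>\<^sub>F t in at_top. \<epsilon> t \<noteq> 0"
    using ev by eventually_elim (use eps_pos in force)
  have resid: "((\<lambda>t. norm (A *v x t - b) / \<epsilon> t) \<longlongrightarrow> 0) at_top"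
    using tendsto_norm_zero[OF scaled_residual_tendsto]
    by (rule Lim_transform_eventually) (use ev in eventually_elim, use eps_pos e_sq in \<open>simp add: less_imp_le\<close>)
  have gap: "((\<lambda>t. gap (x t) / \<epsilon> t) \<longlongrightarrow> 0) at_top"
    using scaled_gap_tendsto
    by (rule Lim_transform_eventually) (use ev in eventually_elim, use e_sq in simp)
  show ?thesis
  proof (intro conjI)
    show "(\<lambda>t. norm (x' t)) \<in> o(\<lambda>t. sqrt (\<epsilon> t))"
    proof (rule smalloI_tendsto)
      show "((\<lambda>t. norm (x' t) / sqrt (\<epsilon> t)) \<longlongrightarrow> 0) at_top"
        using tendsto_norm_zero[OF velocity_tendsto]
        by (rule Lim_transform_eventually)
           (use ev in eventually_elim, use eps_pos in \<open>simp add: v_def e_def less_imp_le\<close>)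
    qed (use eps_ne in eventually_elim, simp)
    show "(\<lambda>t. lagrangian f A b (x t) lamdag - lagrangian f A b xstar lamdag) \<in> o(\<epsilon>)"
      using gap eps_ne by (intro smalloI_tendsto) (simp_all add: gap_def)
    show "(\<lambda>t. norm (A *v x t - b)) \<in> o(\<epsilon>)"
      using resid eps_ne by (rule smalloI_tendsto)
    show "(\<lambda>t. \<bar>f (x t) - f xstar\<bar>) \<in> o(\<epsilon>)"
    proof (rule smalloI_tendsto[OF _ eps_ne])
      have "((\<lambda>t. gap (x t) / \<epsilon> t + norm lamdag * (norm (A *v x t - b) / \<epsilon> t)) \<longlongrightarrow> 0 + norm lamdag * 0) at_top"
        by (intro tendsto_intros gap resid)
      then have lim: "((\<lambda>t. gap (x t) / \<epsilon> t + norm lamdag * (norm (A *v x t - b) / \<epsilon> t)) \<longlongrightarrow> 0) at_top"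
        by simp
      show "((\<lambda>t. \<bar>f (x t) - f xstar\<bar> / \<epsilon> t) \<longlongrightarrow> 0) at_top"
      proof (rule tendsto_sandwich[OF _ _ tendsto_const lim])
        show "\<forall>\<^sub>F t in at_top. 0 \<le> \<bar>f (x t) - f xstar\<bar> / \<epsilon> t"
          using ev by eventually_elim (use eps_pos in \<open>simp add: less_imp_le\<close>)
        show "\<forall>\<^sub>F t in at_top. \<bar>f (x t) - f xstar\<bar> / \<epsilon> t
            \<le> gap (x t) / \<epsilon> t + norm lamdag * (norm (A *v x t - b) / \<epsilon> t)"
          using ev
        proof eventually_elim
          case (elim t)
          \<comment> \<open>The error in the value differs from the gap by a product with the
            residual, and both are already known to be small compared with
            \<open>\<epsilon>\<close>.\<close>
          have "f (x t) - f xstar = gap (x t) - lamdag \<bullet> (A *v x t - b)"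
            by (simp add: gap_def lagrangian_def feasible)
          then have "\<bar>f (x t) - f xstar\<bar> \<le> gap (x t) + norm lamdag * norm (A *v x t - b)"
            using gap_nonneg[of "x t"] Cauchy_Schwarz_ineq2[of lamdag "A *v x t - b"] by linarith
          then have "\<bar>f (x t) - f xstar\<bar> / \<epsilon> t \<le> (gap (x t) + norm lamdag * norm (A *v x t - b)) / \<epsilon> t"
            using eps_pos[OF elim] by (intro divide_right_mono) auto
          then show ?case
            by (simp add: add_divide_distrib)
        qed
      qed
    qed
  qed
qed

end
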